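(* Suppose that $G=A\ast B$ is the free product of $A$ and $B$, where $A,B$ are non-trivial residually finite groups. Then $Aut_n^f(G)=Inn(G)$.
   Context: For a group $G$, $Aut_n^f(G)$ denotes the group of automorphisms of $G$ that stabilize (setwise) every normal subgroup of finite index in $G$; $Inn(G)$ is the group of inner automorphisms. The groups $A$ and $B$ are not assumed to be finitely generated. *)

theory Defs
  imports "HOL-Algebra.Algebra"
begin

section \<open>Free products of two groups\<close>

text \<open>The free product is realised on reduced words: lists of non-trivial elements of \<open>A\<close>
  (tagged \<open>Inl\<close>) and of \<open>B\<close> (tagged \<open>Inr\<close>) in which neighbouring letters come from different
  factors. The empty word is the unit.\<close>

definition reduced_words ::
    "('a, 'm) monoid_scheme \<Rightarrow> ('b, 'n) monoid_scheme \<Rightarrow> ('a + 'b) list set" where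
  "reduced_words A B =
     {w. set w \<subseteq> Inl ` (carrier A - {\<one>\<^bsub>A\<^esub>}) \<union> Inr ` (carrier B - {\<one>\<^bsub>B\<^esub>}) \<and>
         distinct_adj (map isl w)}"

text \<open>Left multiplication of a reduced word by one (possibly trivial) element of a factor.\<close>

fun letter_mult ::
    "('a, 'm) monoid_scheme \<Rightarrow> ('b, 'n) monoid_scheme \<Rightarrow> 'a + 'b \<Rightarrow> ('a + 'b) list \<Rightarrow> ('a + 'b) list"
where
  "letter_mult A B (Inl a) (Inl a' # w) =
     (if a \<otimes>\<^bsub>A\<^esub> a' = \<one>\<^bsub>A\<^esub> then w else Inl (a \<otimes>\<^bsub>A\<^esub> a') # w)"
| "letter_mult A B (Inr b) (Inr b' # w) =
     (if b \<otimes>\<^bsub>B\<^esub> b' = \<one>\<^bsub>B\<^esub> then w else Inr (b \<otimes>\<^bsub>B\<^esub> b') # w)"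
| "letter_mult A B x w = (if x = Inl \<one>\<^bsub>A\<^esub> \<or> x = Inr \<one>\<^bsub>B\<^esub> then w else x # w)"

definition free_product ::
    "('a, 'm) monoid_scheme \<Rightarrow> ('b, 'n) monoid_scheme \<Rightarrow> ('a + 'b) list monoid" where
  "free_product A B =
     \<lparr>carrier = reduced_words A B, monoid.mult = foldr (letter_mult A B), one = []\<rparr>"

lemma distinct_adj_isl_Cons:
  "distinct_adj (map isl (x # w)) \<longleftrightarrow>
     (w = [] \<or> isl x \<noteq> isl (hd w)) \<and> distinct_adj (map isl w)"
  by (cases w) (auto simp: distinct_adj_Cons)

lemma reduced_words_Nil [simp]: "[] \<in> reduced_words A B"
  by (simp add: reduced_words_def)

lemma reduced_words_Inl_Cons:
  "Inl a # w \<in> reduced_words A B \<longleftrightarrow>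
     a \<in> carrier A \<and> a \<noteq> \<one>\<^bsub>A\<^esub> \<and> w \<in> reduced_words A B \<and> (w = [] \<or> \<not> isl (hd w))"
  unfolding reduced_words_def mem_Collect_eq distinct_adj_isl_Cons by auto

lemma reduced_words_Inr_Cons:
  "Inr b # w \<in> reduced_words A B \<longleftrightarrow>
     b \<in> carrier B \<and> b \<noteq> \<one>\<^bsub>B\<^esub> \<and> w \<in> reduced_words A B \<and> (w = [] \<or> isl (hd w))"
  unfolding reduced_words_def mem_Collect_eq distinct_adj_isl_Cons by auto

lemmas reduced_words_Cons = reduced_words_Inl_Cons reduced_words_Inr_Cons

lemma letter_mult_Inl_other:
  "w = [] \<or> \<not> isl (hd w) \<Longrightarrow> letter_mult A B (Inl a) w = (if a = \<one>\<^bsub>A\<^esub> then w else Inl a # w)"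
  by (cases w; cases "hd w") auto

lemma letter_mult_Inr_other:
  "w = [] \<or> isl (hd w) \<Longrightarrow> letter_mult A B (Inr b) w = (if b = \<one>\<^bsub>B\<^esub> then w else Inr b # w)"
  by (cases w; cases "hd w") auto

lemma word_cases_Inl:
  obtains (same) a w' where "w = Inl a # w'" | (other) "w = [] \<or> \<not> isl (hd w)"
  by (cases w; cases "hd w") auto

lemma word_cases_Inr:
  obtains (same) b w' where "w = Inr b # w'" | (other) "w = [] \<or> isl (hd w)"
  by (cases w; cases "hd w") auto

context
  fixes A :: "('a, 'm) monoid_scheme" and B :: "('b, 'n) monoid_scheme"
  assumes A: "group A" and B: "group B"
begin

interpretation A: group A by (rule A)
interpretation B: group B by (rule B)

lemma letter_mult_Inl_closed:
  assumes "a \<in> carrier A" "w \<in> reduced_words A B"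
  shows "letter_mult A B (Inl a) w \<in> reduced_words A B"
  by (cases w rule: word_cases_Inl)
     (use assms in \<open>auto simp: letter_mult_Inl_other reduced_words_Cons\<close>)

lemma letter_mult_Inr_closed:
  assumes "b \<in> carrier B" "w \<in> reduced_words A B"
  shows "letter_mult A B (Inr b) w \<in> reduced_words A B"
  by (cases w rule: word_cases_Inr)
     (use assms in \<open>auto simp: letter_mult_Inr_other reduced_words_Cons\<close>)

lemma letter_mult_Inl_Inl:
  assumes "a \<in> carrier A" "a' \<in> carrier A" "w \<in> reduced_words A B"
  shows "letter_mult A B (Inl a) (letter_mult A B (Inl a') w) = letter_mult A B (Inl (a \<otimes>\<^bsub>A\<^esub> a')) w"
proof (cases w rule: word_cases_Inl)
  case (same c w')
  then have c: "c \<in> carrier A" "c \<noteq> \<one>\<^bsub>A\<^esub>" "w' = [] \<or> \<not> isl (hd w')"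
    using assms by (auto simp: reduced_words_Cons)
  show ?thesis
  proof (cases "a' \<otimes>\<^bsub>A\<^esub> c = \<one>\<^bsub>A\<^esub>")
    case True
    then show ?thesis
      using assms c same by (auto simp: letter_mult_Inl_other A.m_assoc)
  next
    case False
    then show ?thesis using assms c same by (simp add: A.m_assoc)
  qed
next
  case other
  then show ?thesis using assms by (auto simp: letter_mult_Inl_other)
qed

lemma letter_mult_Inr_Inr:
  assumes "b \<in> carrier B" "b' \<in> carrier B" "w \<in> reduced_words A B"
  shows "letter_mult A B (Inr b) (letter_mult A B (Inr b') w) = letter_mult A B (Inr (b \<otimes>\<^bsub>B\<^esub> b')) w"
proof (cases w rule: word_cases_Inr)
  case (same c w')
  then have c: "c \<in> carrier B" "c \<noteq> \<one>\<^bsub>B\<^esub>" "w' = [] \<or> isl (hd w')"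
    using assms by (auto simp: reduced_words_Cons)
  show ?thesis
  proof (cases "b' \<otimes>\<^bsub>B\<^esub> c = \<one>\<^bsub>B\<^esub>")
    case True
    then show ?thesis
      using assms c same by (auto simp: letter_mult_Inr_other B.m_assoc)
  next
    case False
    then show ?thesis using assms c same by (simp add: B.m_assoc)
  qed
next
  case other
  then show ?thesis using assms by (auto simp: letter_mult_Inr_other)
qed

lemma letter_mult_one:
  assumes "w \<in> reduced_words A B"
  shows "letter_mult A B (Inl \<one>\<^bsub>A\<^esub>) w = w" "letter_mult A B (Inr \<one>\<^bsub>B\<^esub>) w = w"
  subgoal by (cases w rule: word_cases_Inl)
     (use assms in \<open>auto simp: letter_mult_Inl_other reduced_words_Cons\<close>)
  subgoal by (cases w rule: word_cases_Inr)
     (use assms in \<open>auto simp: letter_mult_Inr_other reduced_words_Cons\<close>)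
  done

lemma letter_mult_Cons:
  assumes "x # w \<in> reduced_words A B"
  shows "letter_mult A B x w = x # w"
  using assms by (cases x) (auto simp: reduced_words_Cons letter_mult_Inl_other letter_mult_Inr_other)

lemma foldr_letter_mult_closed:
  assumes "u \<in> reduced_words A B" "v \<in> reduced_words A B"
  shows "foldr (letter_mult A B) u v \<in> reduced_words A B"
  using assms(1)
proof (induction u)
  case (Cons x u)
  then show ?case
    by (cases x) (auto simp: reduced_words_Cons letter_mult_Inl_closed letter_mult_Inr_closed)
qed (use assms in simp)

lemma foldr_letter_mult_Inl:
  assumes "a \<in> carrier A" "v \<in> reduced_words A B" "w \<in> reduced_words A B"
  shows "foldr (letter_mult A B) (letter_mult A B (Inl a) v) w =
         letter_mult A B (Inl a) (foldr (letter_mult A B) v w)"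
proof (cases v rule: word_cases_Inl)
  case (same c v')
  then have "c \<in> carrier A" "v' \<in> reduced_words A B" using assms by (auto simp: reduced_words_Cons)
  then show ?thesis
    using assms same by (auto simp: letter_mult_Inl_Inl foldr_letter_mult_closed letter_mult_one)
next
  case other
  then show ?thesis
    using assms by (auto simp: letter_mult_Inl_other[of v] foldr_letter_mult_closed letter_mult_one)
qed

lemma foldr_letter_mult_Inr:
  assumes "b \<in> carrier B" "v \<in> reduced_words A B" "w \<in> reduced_words A B"
  shows "foldr (letter_mult A B) (letter_mult A B (Inr b) v) w =
         letter_mult A B (Inr b) (foldr (letter_mult A B) v w)"
proof (cases v rule: word_cases_Inr)
  case (same c v')
  then have "c \<in> carrier B" "v' \<in> reduced_words A B" using assms by (auto simp: reduced_words_Cons)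
  then show ?thesis
    using assms same by (auto simp: letter_mult_Inr_Inr foldr_letter_mult_closed letter_mult_one)
next
  case other
  then show ?thesis
    using assms by (auto simp: letter_mult_Inr_other[of v] foldr_letter_mult_closed letter_mult_one)
qed

lemma foldr_letter_mult_assoc:
  assumes "u \<in> reduced_words A B" "v \<in> reduced_words A B" "w \<in> reduced_words A B"
  shows "foldr (letter_mult A B) (foldr (letter_mult A B) u v) w =
         foldr (letter_mult A B) u (foldr (letter_mult A B) v w)"
  using assms(1)
proof (induction u)
  case (Cons x u)
  then show ?case
    using assms(2,3)
    by (cases x) (auto simp: reduced_words_Cons foldr_letter_mult_closed
        foldr_letter_mult_Inl foldr_letter_mult_Inr)
qed simp

lemma foldr_letter_mult_left_inverse:
  assumes "u \<in> reduced_words A B"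
  shows "\<exists>v\<in>reduced_words A B. foldr (letter_mult A B) v u = []"
  using assms
proof (induction u)
  case Nil
  then show ?case by (intro bexI[of _ "[]"]) auto
next
  case (Cons x u)
  then have u: "u \<in> reduced_words A B" by (cases x) (auto simp: reduced_words_Cons)
  with Cons obtain v where v: "v \<in> reduced_words A B" "foldr (letter_mult A B) v u = []"
    by auto
  have "\<exists>y. [y] \<in> reduced_words A B \<and> letter_mult A B y (x # u) = u"
  proof (cases x)
    case (Inl a)
    then show ?thesis using Cons.prems
      by (intro exI[of _ "Inl (inv\<^bsub>A\<^esub> a)"]) (auto simp: reduced_words_Cons)
  next
    case (Inr b)
    then show ?thesis using Cons.prems
      by (intro exI[of _ "Inr (inv\<^bsub>B\<^esub> b)"]) (auto simp: reduced_words_Cons)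
  qed
  then obtain y where y: "[y] \<in> reduced_words A B" "foldr (letter_mult A B) [y] (x # u) = u"
    by auto
  show ?case
    using foldr_letter_mult_assoc[OF v(1) y(1) Cons.prems] v y
    by (intro bexI[of _ "foldr (letter_mult A B) v [y]"]) (simp_all add: foldr_letter_mult_closed)
qed

lemma group_free_product: "group (free_product A B)"
  by (rule groupI)
     (auto simp: free_product_def foldr_letter_mult_closed foldr_letter_mult_assoc
        foldr_letter_mult_left_inverse)

text \<open>The canonical embeddings of the factors are \<open>\<lambda>a. letter_mult A B (Inl a) []\<close> and
  \<open>\<lambda>b. letter_mult A B (Inr b) []\<close>; the universal property holds with respect to them.\<close>

lemma hom_free_product_Inl: "(\<lambda>a. letter_mult A B (Inl a) []) \<in> hom A (free_product A B)"
  using foldr_letter_mult_Inl[where v = "[]"]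
  by (auto simp: hom_def free_product_def reduced_words_Cons)

lemma hom_free_product_Inr: "(\<lambda>b. letter_mult A B (Inr b) []) \<in> hom B (free_product A B)"
  using foldr_letter_mult_Inr[where v = "[]"]
  by (auto simp: hom_def free_product_def reduced_words_Cons)

lemma free_product_universal:
  assumes "group H" and f: "f \<in> hom A H" and g: "g \<in> hom B H"
  shows "\<exists>!h. h \<in> extensional (carrier (free_product A B)) \<and> h \<in> hom (free_product A B) H \<and>
           (\<forall>a\<in>carrier A. h (letter_mult A B (Inl a) []) = f a) \<and>
           (\<forall>b\<in>carrier B. h (letter_mult A B (Inr b) []) = g b)"
proof -
  interpret H: group H by fact
  interpret f: group_hom A H f by unfold_locales (rule f)
  interpret g: group_hom B H g by unfold_locales (rule g)
  define e where "e = (\<lambda>w. foldr (\<lambda>x z. case_sum f g x \<otimes>\<^bsub>H\<^esub> z) w \<one>\<^bsub>H\<^esub>)"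
  have e_simps: "e [] = \<one>\<^bsub>H\<^esub>" "e (Inl a # w) = f a \<otimes>\<^bsub>H\<^esub> e w" "e (Inr b # w) = g b \<otimes>\<^bsub>H\<^esub> e w"
    for a b w by (simp_all add: e_def)
  have e_closed: "e w \<in> carrier H" if "w \<in> reduced_words A B" for w
    using that
  proof (induction w)
    case (Cons x w)
    then show ?case by (cases x) (auto simp: reduced_words_Cons e_simps)
  qed (simp add: e_simps)
  have e_Inl: "e (letter_mult A B (Inl a) w) = f a \<otimes>\<^bsub>H\<^esub> e w"
    if "a \<in> carrier A" "w \<in> reduced_words A B" for a w
  proof (cases w rule: word_cases_Inl)
    case (same c w')
    then have c: "c \<in> carrier A" "w' \<in> reduced_words A B"
      using that by (auto simp: reduced_words_Cons)
    have "f (a \<otimes>\<^bsub>A\<^esub> c) \<otimes>\<^bsub>H\<^esub> e w' = f a \<otimes>\<^bsub>H\<^esub> (f c \<otimes>\<^bsub>H\<^esub> e w')"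
      using c that e_closed by (simp add: H.m_assoc)
    then show ?thesis
      using c that same e_closed by (auto simp: e_simps simp del: f.hom_mult)
  next
    case other
    then show ?thesis using that e_closed by (auto simp: letter_mult_Inl_other e_simps)
  qed
  have e_Inr: "e (letter_mult A B (Inr b) w) = g b \<otimes>\<^bsub>H\<^esub> e w"
    if "b \<in> carrier B" "w \<in> reduced_words A B" for b w
  proof (cases w rule: word_cases_Inr)
    case (same c w')
    then have c: "c \<in> carrier B" "w' \<in> reduced_words A B"
      using that by (auto simp: reduced_words_Cons)
    have "g (b \<otimes>\<^bsub>B\<^esub> c) \<otimes>\<^bsub>H\<^esub> e w' = g b \<otimes>\<^bsub>H\<^esub> (g c \<otimes>\<^bsub>H\<^esub> e w')"
      using c that e_closed by (simp add: H.m_assoc)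
    then show ?thesis
      using c that same e_closed by (auto simp: e_simps simp del: g.hom_mult)
  next
    case other
    then show ?thesis using that e_closed by (auto simp: letter_mult_Inr_other e_simps)
  qed
  have e_mult: "e (foldr (letter_mult A B) u v) = e u \<otimes>\<^bsub>H\<^esub> e v"
    if "u \<in> reduced_words A B" "v \<in> reduced_words A B" for u v
    using that(1)
  proof (induction u)
    case (Cons x u)
    then show ?case
      using that(2) by (cases x) (auto simp: reduced_words_Cons e_simps e_Inl e_Inr
          foldr_letter_mult_closed H.m_assoc e_closed)
  qed (use that e_closed in \<open>simp add: e_simps\<close>)
  let ?e = "restrict e (reduced_words A B)"
  show ?thesis
  proof (rule ex1I[of _ ?e], intro conjI ballI)
    show "?e \<in> hom (free_product A B) H"
      by (auto simp: hom_def free_product_def e_closed e_mult foldr_letter_mult_closed)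
    show "?e (letter_mult A B (Inl a) []) = f a" if "a \<in> carrier A" for a
      using that letter_mult_Inl_closed[OF that reduced_words_Nil] e_Inl[OF that reduced_words_Nil]
      by (simp add: e_simps del: letter_mult.simps)
    show "?e (letter_mult A B (Inr b) []) = g b" if "b \<in> carrier B" for b
      using that letter_mult_Inr_closed[OF that reduced_words_Nil] e_Inr[OF that reduced_words_Nil]
      by (simp add: e_simps del: letter_mult.simps)
  next
    fix h
    assume h: "h \<in> extensional (carrier (free_product A B)) \<and> h \<in> hom (free_product A B) H \<and>
           (\<forall>a\<in>carrier A. h (letter_mult A B (Inl a) []) = f a) \<and>
           (\<forall>b\<in>carrier B. h (letter_mult A B (Inr b) []) = g b)"
    interpret h: group_hom "free_product A B" H h
      using h \<open>group H\<close> group_free_product by (simp add: group_hom_def group_hom_axioms_def)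
    have "h w = e w" if "w \<in> reduced_words A B" for w
      using that
    proof (induction w)
      case Nil
      then show ?case using h.hom_one by (simp add: free_product_def e_simps)
    next
      case (Cons x w)
      then have w: "w \<in> reduced_words A B" "[x] \<in> reduced_words A B"
        by (cases x; auto simp: reduced_words_Cons)+
      have "h (x # w) = h [x] \<otimes>\<^bsub>H\<^esub> h w"
        using h.hom_mult[of "[x]" w] w letter_mult_Cons[OF Cons.prems]
        by (simp add: free_product_def)
      moreover have "h [x] = case_sum f g x"
        using h Cons.prems by (cases x) (auto simp: reduced_words_Cons split: if_splits)
      ultimately show ?case using Cons w by (simp add: e_def)
    qed
    then show "h = ?e"
      using h by (intro extensionalityI[of _ "reduced_words A B"]) (auto simp: free_product_def)
  qed (simp add: free_product_def)
qed

end


section \<open>Residual finiteness and normal automorphisms\<close>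

definition finite_index_normal :: "'a set \<Rightarrow> ('a, 'm) monoid_scheme \<Rightarrow> bool" where
  "finite_index_normal N G \<longleftrightarrow> N \<lhd> G \<and> finite (rcosets\<^bsub>G\<^esub> N)"

definition residually_finite :: "('a, 'm) monoid_scheme \<Rightarrow> bool" where
  "residually_finite G \<longleftrightarrow>
     (\<forall>g\<in>carrier G. g \<noteq> \<one>\<^bsub>G\<^esub> \<longrightarrow> (\<exists>N. finite_index_normal N G \<and> g \<notin> N))"

text \<open>Both groups of automorphisms are given as subsets of the library's \<^const>\<open>auto\<close>, the
  carrier of \<^const>\<open>AutoGroup\<close>; its elements are extensional, i.e. \<open>undefined\<close> outside the
  carrier, hence the bounded abstraction for inner automorphisms.\<close>

definition Aut_nf :: "('a, 'm) monoid_scheme \<Rightarrow> ('a \<Rightarrow> 'a) set" where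
  "Aut_nf G = {\<phi> \<in> auto G. \<forall>N. finite_index_normal N G \<longrightarrow> \<phi> ` N = N}"

definition Inn :: "('a, 'm) monoid_scheme \<Rightarrow> ('a \<Rightarrow> 'a) set" where
  "Inn G = {\<lambda>x\<in>carrier G. g \<otimes>\<^bsub>G\<^esub> x \<otimes>\<^bsub>G\<^esub> inv\<^bsub>G\<^esub> g | g. g \<in> carrier G}"

end

theory Submission
  imports Defs "HOL-Number_Theory.Cong"
begin

text \<open>Let \<open>\<phi>\<close> preserve all normal subgroups of finite index of \<open>P = A * B\<close>. Then \<open>\<phi>\<close> preserves the kernel of
  every homomorphism to a residually finite group.

  If \<open>\<phi> a\<close>, with \<open>a \<in> A\<close>, were conjugate to a cyclically reduced word \<open>c\<close> of length at least 2, map \<open>P\<close> to a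
  free product of finite quotients of \<open>A\<close> and \<open>B\<close> that kill no letter of \<open>c\<close>: this group is residually finite, some
  power of \<open>a\<close> dies in it, but no power of \<open>c\<close> does. Hence \<open>\<phi> a\<close> is conjugate into a factor, and the
  retraction \<open>P \<rightarrow> A\<close> shows that this factor is \<open>A\<close>. As products of elements of two different conjugates of
  \<open>A\<close> are conjugate to cyclically reduced words of length at least 2, \<open>\<phi>\<close> maps \<open>A\<close>, and likewise \<open>B\<close>, into a
  single conjugate of itself. By surjectivity one inner automorphism moves both images back into \<open>A\<close> and \<open>B\<close>.

  It remains to see that such a \<open>\<phi>\<close> with \<open>\<phi> A \<subseteq> A\<close> and \<open>\<phi> B \<subseteq> B\<close> is the identity. If \<open>\<phi> a \<noteq> a\<close> and \<open>b \<in> B\<close> is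
  nontrivial, then \<open>P\<close> has a finite quotient inside some \<open>M \<rtimes> (A' \<times> B')\<close>, with \<open>M\<close> abelian and \<open>A'\<close>, \<open>B'\<close> finite
  quotients of \<open>A\<close>, \<open>B\<close>, in which the relation \<open>x c x\<inverse> = c\<^sup>3\<close> for \<open>c = [x, y]\<close> holds at \<open>(a, b)\<close> but fails at
  \<open>(\<phi> a, \<phi> b)\<close>.\<close>

section \<open>Finite quotients\<close>

lemma (in group) inv_mult_cancel:
  "x \<in> carrier G \<Longrightarrow> y \<in> carrier G \<Longrightarrow> inv x \<otimes> (x \<otimes> y) = y"
  "x \<in> carrier G \<Longrightarrow> y \<in> carrier G \<Longrightarrow> x \<otimes> (inv x \<otimes> y) = y"
  by (simp_all flip: m_assoc)

lemma (in group) pow_conj: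
  assumes "u \<in> carrier G" "x \<in> carrier G"
  shows "(u \<otimes> x \<otimes> inv u) [^] (n::nat) = u \<otimes> x [^] n \<otimes> inv u"
  using assms by (induction n) (simp_all add: m_assoc inv_mult_cancel)

text \<open>The first isomorphism theorem embeds the quotient into the image of \<open>h\<close>, so
  finiteness is asked of the image and not of \<open>H\<close>.\<close>

lemma finite_index_normal_kernel:
  assumes "group_hom G H h" "finite (h ` carrier G)"
  shows "finite_index_normal (kernel G H h) G"
proof -
  interpret group_hom G H h by fact
  let ?Q = "G Mod kernel G H h"
  have "finite ((\<lambda>C. the_elem (h ` C)) ` carrier ?Q)"
  proof (rule finite_subset[OF _ assms(2)], rule image_subsetI)
    fix C assume "C \<in> carrier ?Q"
    then obtain g where g: "g \<in> carrier G" "C = kernel G H h #>\<^bsub>G\<^esub> g"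
      by (auto simp: FactGroup_def RCOSETS_def)
    then have "g \<in> C"
      using subgroup_kernel by (simp add: G.rcos_self)
    moreover have "h x = h g" if "x \<in> C" for x
      using that g by (auto simp: r_coset_def kernel_def)
    ultimately have "h ` C = {h g}" by blast
    with g(1) show "the_elem (h ` C) \<in> h ` carrier G" by simp
  qed
  from this FactGroup_inj_on have "finite (carrier ?Q)"
    by (rule finite_imageD)
  then show ?thesis
    by (simp add: finite_index_normal_def normal_kernel FactGroup_def)
qed

lemma finite_index_normal_Mod:
  assumes "finite_index_normal N G"
  shows "group (G Mod N)" "finite (carrier (G Mod N))" "(\<lambda>x. N #>\<^bsub>G\<^esub> x) \<in> hom G (G Mod N)"
proof -
  interpret normal N G using assms by (simp add: finite_index_normal_def)
  show "group (G Mod N)" "finite (carrier (G Mod N))" "(\<lambda>x. N #>\<^bsub>G\<^esub> x) \<in> hom G (G Mod N)"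
    using assms factorgroup_is_group r_coset_hom_Mod
    by (simp_all add: finite_index_normal_def FactGroup_def)
qed

lemma (in normal) r_coset_eq_self_iff: "x \<in> carrier G \<Longrightarrow> H #>\<^bsub>G\<^esub> x = H \<longleftrightarrow> x \<in> H"
  using coset_join1 coset_join2 subgroup_axioms is_group by (metis subset)

text \<open>The intersection is the kernel of the diagonal map into the product of the two finite
  quotients.\<close>

lemma finite_index_normal_Int:
  assumes "finite_index_normal M G" "finite_index_normal N G"
  shows "finite_index_normal (M \<inter> N) G"
proof -
  interpret M: normal M G using assms(1) by (simp add: finite_index_normal_def)
  interpret N: normal N G using assms(2) by (simp add: finite_index_normal_def)
  note M = finite_index_normal_Mod[OF assms(1)] and N = finite_index_normal_Mod[OF assms(2)]
  let ?H = "(G Mod M) \<times>\<times> (G Mod N)" and ?h = "\<lambda>x. (M #>\<^bsub>G\<^esub> x, N #>\<^bsub>G\<^esub> x)"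
  have "group_hom G ?H ?h"
    using M N DirProd_group M.is_group
    by (auto simp: group_hom_def group_hom_axioms_def hom_def Pi_def)
  moreover have "finite (?h ` carrier G)"
    by (rule finite_subset[of _ "carrier (G Mod M) \<times> carrier (G Mod N)"])
       (use M N in \<open>auto simp: hom_def\<close>)
  ultimately have "finite_index_normal (kernel G ?H ?h) G"
    by (rule finite_index_normal_kernel)
  also have "kernel G ?H ?h = M \<inter> N"
  proof (rule Set.set_eqI)
    fix x
    have "x \<in> carrier G" if "x \<in> M" using that M.subset by blast
    then show "x \<in> kernel G ?H ?h \<longleftrightarrow> x \<in> M \<inter> N"
      using M.r_coset_eq_self_iff[of x] N.r_coset_eq_self_iff[of x]
      by (cases "x \<in> carrier G") (simp_all only: kernel_def mem_Collect_eq one_DirProd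
          one_FactGroup prod.inject simp_thms Int_iff, blast)
  qed
  finally show ?thesis .
qed

lemma finite_index_normal_carrier: "group G \<Longrightarrow> finite_index_normal (carrier G) G"
proof -
  assume "group G"
  then interpret group G .
  have "kernel G G (\<lambda>_. \<one>\<^bsub>G\<^esub>) = carrier G"
    by (auto simp: kernel_def)
  then show ?thesis
    using finite_index_normal_kernel[of G G "\<lambda>_. \<one>\<^bsub>G\<^esub>"] \<open>group G\<close>
    by (simp add: group_hom_def group_hom_axioms_def image_constant_conv hom_def)
qed

lemma residually_finite_avoid:
  assumes "group G" "residually_finite G" "finite S" "S \<subseteq> carrier G - {\<one>\<^bsub>G\<^esub>}"
  obtains N where "finite_index_normal N G" "S \<inter> N = {}"
proof -
  have "\<exists>N. finite_index_normal N G \<and> S \<inter> N = {}"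
    using assms(3,4)
  proof (induction S)
    case empty
    then show ?case using finite_index_normal_carrier[OF assms(1)] by auto
  next
    case (insert x S)
    then obtain N where "finite_index_normal N G" "S \<inter> N = {}" by auto
    moreover obtain M where "finite_index_normal M G" "x \<notin> M"
      using assms(2) insert.prems by (auto simp: residually_finite_def)
    ultimately show ?case
      by (intro exI[of _ "M \<inter> N"]) (auto simp: finite_index_normal_Int)
  qed
  with that show thesis by blast
qed

text \<open>Residual finiteness in the form used below: factor out a subgroup avoiding all of
  \<open>S\<close>, obtained by intersecting one subgroup per element.\<close>

lemma residually_finite_hom:
  fixes G :: "('a, 'm) monoid_scheme"
  assumes "group G" "residually_finite G" "finite S" "S \<subseteq> carrier G - {\<one>\<^bsub>G\<^esub>}"
  obtains Q :: "'a set monoid" and q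
  where "group Q" "finite (carrier Q)" "q \<in> hom G Q" "\<forall>x\<in>S. q x \<noteq> \<one>\<^bsub>Q\<^esub>"
proof -
  obtain N where N: "finite_index_normal N G" "S \<inter> N = {}"
    using residually_finite_avoid[OF assms] .
  interpret normal N G using N by (simp add: finite_index_normal_def)
  have "\<forall>x\<in>S. N #>\<^bsub>G\<^esub> x \<noteq> \<one>\<^bsub>G Mod N\<^esub>"
    using N assms(4) r_coset_eq_self_iff by auto
  with finite_index_normal_Mod[OF N(1)] show thesis by (rule that)
qed

section \<open>Actions on finite sets\<close>

lemma finite_carrier_BijGroup:
  assumes "finite E"
  shows "finite (carrier (BijGroup E))"
proof (rule finite_subset)
  show "carrier (BijGroup E) \<subseteq> E \<rightarrow>\<^sub>E E"
  proof
    fix f assume "f \<in> carrier (BijGroup E)"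
    then have "f \<in> Bij E" by (simp add: BijGroup_def)
    from Bij_imp_funcset[OF this] Bij_imp_extensional[OF this]
    show "f \<in> E \<rightarrow>\<^sub>E E" by (simp add: PiE_def)
  qed
  show "finite (E \<rightarrow>\<^sub>E E)"
    using assms by (simp add: finite_PiE)
qed

lemma mult_BijGroup_apply:
  "p \<in> carrier (BijGroup E) \<Longrightarrow> q \<in> carrier (BijGroup E) \<Longrightarrow> x \<in> E \<Longrightarrow>
    (p \<otimes>\<^bsub>BijGroup E\<^esub> q) x = p (q x)"
  by (simp add: BijGroup_def compose_def)

lemma carrier_BijGroup_eqI:
  assumes "p \<in> carrier (BijGroup E)" "q \<in> carrier (BijGroup E)" "\<And>x. x \<in> E \<Longrightarrow> p x = q x"
  shows "p = q"
  using assms by (auto simp: BijGroup_def Bij_def intro: extensionalityI)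

lemma hom_BijGroupI:
  assumes "group G"
    and closed: "\<And>g x. g \<in> carrier G \<Longrightarrow> x \<in> E \<Longrightarrow> act g x \<in> E"
    and one: "\<And>x. x \<in> E \<Longrightarrow> act \<one>\<^bsub>G\<^esub> x = x"
    and mult: "\<And>g h x. g \<in> carrier G \<Longrightarrow> h \<in> carrier G \<Longrightarrow> x \<in> E \<Longrightarrow>
      act (g \<otimes>\<^bsub>G\<^esub> h) x = act g (act h x)"
  shows "(\<lambda>g. restrict (act g) E) \<in> hom G (BijGroup E)"
proof -
  interpret group G by fact
  have bij: "restrict (act g) E \<in> Bij E" if g: "g \<in> carrier G" for g
  proof -
    have "bij_betw (act g) E E"
    proof (rule bij_betw_byWitness[of _ "act (inv\<^bsub>G\<^esub> g)"])
      show "\<forall>x\<in>E. act (inv\<^bsub>G\<^esub> g) (act g x) = x" "\<forall>x\<in>E. act g (act (inv\<^bsub>G\<^esub> g) x) = x"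
        using g one by (simp_all flip: mult)
    qed (use g closed in auto)
    then have "bij_betw (restrict (act g) E) E E"
      by (rule bij_betw_cong[THEN iffD1, rotated]) simp
    then show ?thesis by (simp add: Bij_def)
  qed
  show ?thesis
  proof (rule homI)
    interpret S: group "BijGroup E" by (rule group_BijGroup)
    fix g h assume gh: "g \<in> carrier G" "h \<in> carrier G"
    then have mem: "restrict (act x) E \<in> carrier (BijGroup E)" if "x \<in> {g, h, g \<otimes>\<^bsub>G\<^esub> h}" for x
      using that bij by (auto simp: BijGroup_def)
    then show "restrict (act (g \<otimes>\<^bsub>G\<^esub> h)) E = restrict (act g) E \<otimes>\<^bsub>BijGroup E\<^esub> restrict (act h) E"
      using mult[OF gh] closed[OF gh(2)]
      by (intro carrier_BijGroup_eqI[of _ E]) (simp_all add: mult_BijGroup_apply)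
  qed (simp add: bij BijGroup_def)
qed

section \<open>Words in a free product\<close>

locale free_product_groups = A: group A + B: group B
  for A :: "('a, 'm) monoid_scheme" and B :: "('b, 'n) monoid_scheme"
begin

abbreviation P where "P \<equiv> free_product A B"

sublocale P: group P
  by (rule group_free_product) unfold_locales

abbreviation fmult (infixl "\<cdot>" 70) where "u \<cdot> v \<equiv> u \<otimes>\<^bsub>P\<^esub> v"

lemma carrier_P: "carrier P = reduced_words A B"
  and one_P: "\<one>\<^bsub>P\<^esub> = []"
  and mult_P: "u \<cdot> v = foldr (letter_mult A B) u v"
  by (simp_all add: free_product_def)

lemma Nil_closed [simp]: "[] \<in> carrier P"
  by (simp add: carrier_P)

lemma Nil_mult [simp]: "u \<in> carrier P \<Longrightarrow> [] \<cdot> u = u" "u \<in> carrier P \<Longrightarrow> u \<cdot> [] = u"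
  using P.l_one P.r_one by (simp_all add: one_P)

lemma inv_Nil [simp]: "inv\<^bsub>P\<^esub> [] = []"
  using P.inv_one by (simp add: one_P)

lemma append_closed_iff:
  "u @ v \<in> carrier P \<longleftrightarrow>
    u \<in> carrier P \<and> v \<in> carrier P \<and> (u = [] \<or> v = [] \<or> isl (last u) \<noteq> isl (hd v))"
  by (auto simp: carrier_P reduced_words_def distinct_adj_append_iff last_map hd_map)

lemma append_eq_mult: "u @ v \<in> carrier P \<Longrightarrow> u \<cdot> v = u @ v"
proof (induction u)
  case (Cons x u)
  then have "u @ v \<in> carrier P" using append_closed_iff[of "[x]" "u @ v"] by simp
  with Cons show ?case
    by (simp add: mult_P letter_mult_Cons[OF A.is_group B.is_group] carrier_P)
qed (simp add: append_closed_iff)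

lemma Cons_closed_iff:
  "x # v \<in> carrier P \<longleftrightarrow> [x] \<in> carrier P \<and> v \<in> carrier P \<and> (v = [] \<or> isl x \<noteq> isl (hd v))"
  using append_closed_iff[of "[x]" v] by simp

lemma Cons_eq_mult: "x # v \<in> carrier P \<Longrightarrow> [x] \<cdot> v = x # v"
  using append_eq_mult[of "[x]" v] by simp

lemma singleton_closed [simp]:
  "[Inl a] \<in> carrier P \<longleftrightarrow> a \<in> carrier A \<and> a \<noteq> \<one>\<^bsub>A\<^esub>"
  "[Inr b] \<in> carrier P \<longleftrightarrow> b \<in> carrier B \<and> b \<noteq> \<one>\<^bsub>B\<^esub>"
  by (auto simp: carrier_P reduced_words_Cons)

lemma length_letter_mult_le: "length (letter_mult A B x v) \<le> Suc (length v)"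
  by (cases "(A, B, x, v)" rule: letter_mult.cases) auto

lemma length_mult_le: "length (u \<cdot> v) \<le> length u + length v"
proof (induction u)
  case (Cons x u)
  then show ?case
    using length_letter_mult_le[of x "u \<cdot> v"] by (simp add: mult_P)
qed (simp add: mult_P)

section \<open>The embedded factors and extension of homomorphisms\<close>

definition "\<iota>A = (\<lambda>a. letter_mult A B (Inl a) [])"
definition "\<iota>B = (\<lambda>b. letter_mult A B (Inr b) [])"

lemma \<iota>A_eq: "\<iota>A a = (if a = \<one>\<^bsub>A\<^esub> then [] else [Inl a])"
  and \<iota>B_eq: "\<iota>B b = (if b = \<one>\<^bsub>B\<^esub> then [] else [Inr b])"
  by (simp_all add: \<iota>A_def \<iota>B_def)

lemma hom_\<iota>A: "group_hom A P \<iota>A" and hom_\<iota>B: "group_hom B P \<iota>B"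
  unfolding \<iota>A_def \<iota>B_def group_hom_def group_hom_axioms_def
  by (intro conjI A.is_group B.is_group P.is_group
      hom_free_product_Inl[OF A.is_group B.is_group] hom_free_product_Inr[OF A.is_group B.is_group])+

sublocale \<iota>A: group_hom A P \<iota>A by (rule hom_\<iota>A)
sublocale \<iota>B: group_hom B P \<iota>B by (rule hom_\<iota>B)

lemma hom_extend:
  assumes "group H" "f \<in> hom A H" "g \<in> hom B H"
  obtains h where "group_hom P H h" "\<And>a. a \<in> carrier A \<Longrightarrow> h (\<iota>A a) = f a"
    "\<And>b. b \<in> carrier B \<Longrightarrow> h (\<iota>B b) = g b"
proof -
  obtain h where h: "h \<in> hom P H" "\<And>a. a \<in> carrier A \<Longrightarrow> h (\<iota>A a) = f a"
    "\<And>b. b \<in> carrier B \<Longrightarrow> h (\<iota>B b) = g b"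
    using free_product_universal[OF A.is_group B.is_group assms] unfolding \<iota>A_def \<iota>B_def by blast
  with assms(1) P.is_group that show thesis
    by (auto simp: group_hom_def group_hom_axioms_def)
qed

text \<open>The two factors are indexed by a Boolean, so that symmetric arguments are needed only once.\<close>

definition factor :: "bool \<Rightarrow> ('a + 'b) list set" where
  "factor s = {w \<in> carrier P. length w \<le> 1 \<and> (\<forall>x\<in>set w. isl x = s)}"

lemma factor_eq: "factor True = \<iota>A ` carrier A" "factor False = \<iota>B ` carrier B"
proof -
  have 1: "w = [] \<or> (\<exists>a. w = [Inl a]) \<or> (\<exists>b. w = [Inr b])" if "length w \<le> 1"
    for w :: "('a + 'b) list"
    using that by (cases w; cases "hd w") auto
  show "factor True = \<iota>A ` carrier A"
  proof
    show "factor True \<subseteq> \<iota>A ` carrier A"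
    proof
      fix w assume w: "w \<in> factor True"
      with 1[of w] consider "w = []" | a where "w = [Inl a]"
        by (auto simp: factor_def)
      then show "w \<in> \<iota>A ` carrier A"
        using w by cases (auto simp: factor_def \<iota>A_eq image_iff)
    qed
  qed (auto simp: factor_def \<iota>A_eq)
  show "factor False = \<iota>B ` carrier B"
  proof
    show "factor False \<subseteq> \<iota>B ` carrier B"
    proof
      fix w assume w: "w \<in> factor False"
      with 1[of w] consider "w = []" | b where "w = [Inr b]"
        by (auto simp: factor_def)
      then show "w \<in> \<iota>B ` carrier B"
        using w by cases (auto simp: factor_def \<iota>B_eq image_iff)
    qed
  qed (auto simp: factor_def \<iota>B_eq)
qed

lemma subgroup_factor: "subgroup (factor s) P"
  using \<iota>A.img_is_subgroup \<iota>B.img_is_subgroup by (cases s) (simp_all add: factor_eq)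

lemma factor_closed: "w \<in> factor s \<Longrightarrow> w \<in> carrier P"
  by (simp add: factor_def)

lemma factor_cases:
  assumes "w \<in> factor s" obtains "w = []" | x where "w = [x]" "isl x = s"
proof (cases w)
  case (Cons x v)
  with assms show thesis by (intro that(2)[of x]) (simp_all add: factor_def)
qed (rule that(1))

lemma factor_mult [simp]: "u \<in> factor s \<Longrightarrow> v \<in> factor s \<Longrightarrow> u \<cdot> v \<in> factor s"
  and factor_inv [simp]: "u \<in> factor s \<Longrightarrow> inv\<^bsub>P\<^esub> u \<in> factor s"
  and Nil_factor [simp]: "[] \<in> factor s"
  using subgroup.m_closed[OF subgroup_factor] subgroup.m_inv_closed[OF subgroup_factor]
    subgroup.one_closed[OF subgroup_factor] by (simp_all add: one_P)

lemma singleton_factor: "[x] \<in> carrier P \<Longrightarrow> isl x = s \<Longrightarrow> [x] \<in> factor s"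
  by (simp add: factor_def)

section \<open>Double coset representatives and inverses of words\<close>

lemma strip_left:
  assumes "v \<in> carrier P"
  obtains p v' where "p \<in> factor s" "v' \<in> carrier P" "v = p \<cdot> v'" "v' = [] \<or> isl (hd v') \<noteq> s"
proof (cases "v = [] \<or> isl (hd v) \<noteq> s")
  case True
  with assms show thesis by (intro that[of "[]" v]) simp_all
next
  case False
  then obtain x w where "v = x # w" "isl x = s" by (cases v) auto
  with assms Cons_closed_iff[of x w] show thesis
    by (intro that[of "[x]" w]) (auto simp: singleton_factor Cons_eq_mult)
qed

lemma strip_right:
  assumes "v \<in> carrier P"
  obtains v' q where "q \<in> factor s" "v' \<in> carrier P" "v = v' \<cdot> q" "v' = [] \<or> isl (last v') \<noteq> s"
    "v' \<noteq> [] \<longrightarrow> hd v' = hd v"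
proof (cases "v = [] \<or> isl (last v) \<noteq> s")
  case True
  with assms show thesis by (intro that[of "[]" v]) simp_all
next
  case False
  then obtain x w where "v = w @ [x]" "isl x = s" by (cases v rule: rev_cases) auto
  with assms append_closed_iff[of w "[x]"] show thesis
    by (intro that[of "[x]" w]) (auto simp: singleton_factor append_eq_mult)
qed

text \<open>\<open>u\<close> represents the double coset of \<open>v\<close> modulo the two factors
  and has no letter left that they could absorb. This rules out cancellation next to conjugators
  later on.\<close>

lemma strip_both:
  assumes "v \<in> carrier P"
  obtains p u q where "p \<in> factor s" "q \<in> factor t" "u \<in> carrier P" "v = p \<cdot> u \<cdot> q"
    "u = [] \<or> isl (hd u) \<noteq> s \<and> isl (last u) \<noteq> t"
proof -
  obtain p v' where p: "p \<in> factor s" "v' \<in> carrier P" "v = p \<cdot> v'" "v' = [] \<or> isl (hd v') \<noteq> s"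
    by (rule strip_left[OF assms])
  obtain q u where q: "q \<in> factor t" "u \<in> carrier P" "v' = u \<cdot> q" "u = [] \<or> isl (last u) \<noteq> t"
    "u \<noteq> [] \<longrightarrow> hd u = hd v'"
    by (rule strip_right[OF p(2)])
  \<comment> \<open>The first letter of \<open>u\<close> is controlled only through
    \<open>v'\<close>. Were \<open>v'\<close> empty, \<open>u\<close> would be the inverse of
    \<open>q\<close>, hence a letter of the very factor that its last letter avoids.\<close>
  have "v' \<noteq> []" if "u \<noteq> []"
  proof
    assume "v' = []"
    then have "u = inv\<^bsub>P\<^esub> q"
      using q(2,3) factor_closed[OF q(1)] P.inv_equality[of u q] by (simp add: one_P)
    then have "u \<in> factor t" using q(1) by simp
    then show False using q(4) that by (auto elim!: factor_cases)
  qed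
  with p q factor_closed[OF p(1)] factor_closed[OF q(1)] show thesis
    by (intro that[of p q u]) (auto simp: P.m_assoc)
qed

lemma inv_singleton:
  assumes "[x] \<in> carrier P"
  obtains y where "inv\<^bsub>P\<^esub> [x] = [y]" "isl y = isl x"
proof -
  have "inv\<^bsub>P\<^esub> [x] \<in> factor (isl x)" using singleton_factor[OF assms refl] by simp
  moreover have "inv\<^bsub>P\<^esub> [x] \<noteq> []" using assms P.inv_eq_1_iff[of "[x]"] by (simp add: one_P)
  ultimately show thesis using that by (auto elim!: factor_cases)
qed

text \<open>Inversion reverses the word and keeps each letter in its factor, so the two ends trade
  factors.\<close>

lemma inv_ends:
  assumes "w \<in> carrier P" "w \<noteq> []"
  shows "inv\<^bsub>P\<^esub> w \<noteq> [] \<and> isl (hd (inv\<^bsub>P\<^esub> w)) = isl (last w) \<and> isl (last (inv\<^bsub>P\<^esub> w)) = isl (hd w)"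
  using assms
proof (induction w)
  case (Cons x w)
  then have mem: "[x] \<in> carrier P" "w \<in> carrier P" "w = [] \<or> isl x \<noteq> isl (hd w)"
    using Cons_closed_iff[of x w] by auto
  obtain y where y: "inv\<^bsub>P\<^esub> [x] = [y]" "isl y = isl x"
    using inv_singleton[OF mem(1)] .
  have y': "[y] \<in> carrier P" using P.inv_closed[OF mem(1)] by (simp add: y)
  show ?case
  proof (cases "w = []")
    case True
    with y show ?thesis by simp
  next
    case False
    with Cons.IH mem(2) have IH: "inv\<^bsub>P\<^esub> w \<noteq> []" "isl (hd (inv\<^bsub>P\<^esub> w)) = isl (last w)"
      "isl (last (inv\<^bsub>P\<^esub> w)) = isl (hd w)" by auto
    have "inv\<^bsub>P\<^esub> (x # w) = inv\<^bsub>P\<^esub> w \<cdot> [y]"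
      using mem Cons_eq_mult[OF Cons.prems(1)] P.inv_mult_group[OF mem(1,2)] y by simp
    also have "\<dots> = inv\<^bsub>P\<^esub> w @ [y]"
      using mem False IH y y' by (intro append_eq_mult) (simp add: append_closed_iff)
    finally show ?thesis using False IH y by simp
  qed
qed simp

section \<open>Cyclically reduced words\<close>

text \<open>Single letters are excluded on purpose: over finite factors they have finite order,
  while these words have no trivial positive power.\<close>

definition cyclically_reduced :: "('a + 'b) list \<Rightarrow> bool" where
  "cyclically_reduced c \<longleftrightarrow> c \<in> carrier P \<and> c \<noteq> [] \<and> isl (hd c) \<noteq> isl (last c)"

text \<open>Induction on length: if both ends lie in the same factor, conjugation carries the first
  letter to the end, where it fuses with the last one and the word gets shorter.\<close>

lemma conj_cyclically_reduced:
  assumes "w \<in> carrier P"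
  obtains u c where "u \<in> carrier P" "c \<in> carrier P" "w = u \<cdot> c \<cdot> inv\<^bsub>P\<^esub> u"
    "cyclically_reduced c \<or> (\<exists>s. c \<in> factor s)"
proof -
  have "\<exists>u c. u \<in> carrier P \<and> c \<in> carrier P \<and> w = u \<cdot> c \<cdot> inv\<^bsub>P\<^esub> u \<and>
    (cyclically_reduced c \<or> (\<exists>s. c \<in> factor s))"
    using assms
  proof (induction w rule: length_induct)
    case (1 w)
    consider "w = []" | x where "w = [x]" | x v y where "w = x # v @ [y]"
      by (metis append_butlast_last_id list.exhaust)
    then show ?case
    proof cases
      case 3
      show ?thesis
      proof (cases "isl x = isl y")
        case True
        have mem: "[x] \<in> carrier P" "v \<in> carrier P" "[y] \<in> carrier P"
          using 1(2) Cons_closed_iff[of x "v @ [y]"] append_closed_iff[of v "[y]"]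
          by (auto simp: 3)
        have w: "w = [x] \<cdot> (v \<cdot> [y])"
          using 1(2) Cons_closed_iff[of x "v @ [y]"] Cons_eq_mult[of x "v @ [y]"]
            append_eq_mult[of v "[y]"] by (simp add: 3)
        define z where "z = [y] \<cdot> [x]"
        have z: "z \<in> factor (isl x)"
          using mem singleton_factor[of x "isl x"] singleton_factor[of y "isl x"] True by (simp add: z_def)
        have "length (v \<cdot> z) < length w"
          using length_mult_le[of v z] z by (auto simp: 3 factor_def)
        moreover have "v \<cdot> z \<in> carrier P" using mem factor_closed[OF z] by simp
        ultimately obtain u c where u: "u \<in> carrier P" "c \<in> carrier P" "v \<cdot> z = u \<cdot> c \<cdot> inv\<^bsub>P\<^esub> u"
          "cyclically_reduced c \<or> (\<exists>s. c \<in> factor s)"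
          using 1(1) by blast
        have "w = [x] \<cdot> (v \<cdot> z) \<cdot> inv\<^bsub>P\<^esub> [x]"
          using mem by (simp add: w z_def P.m_assoc one_P)
        also have "\<dots> = ([x] \<cdot> u) \<cdot> c \<cdot> inv\<^bsub>P\<^esub> ([x] \<cdot> u)"
          using mem u by (simp add: P.m_assoc P.inv_mult_group)
        finally show ?thesis
          using mem u by (intro exI[of _ "[x] \<cdot> u"] exI[of _ c]) simp
      next
        case False
        with 1(2) have "cyclically_reduced w" by (simp add: cyclically_reduced_def 3)
        with 1(2) show ?thesis by (intro exI[of _ "[]"] exI[of _ w]) simp
      qed
    next
      case 2
      with 1(2) have "w \<in> factor (isl x)" by (simp add: singleton_factor)
      with 1(2) show ?thesis by (intro exI[of _ "[]"] exI[of _ w]) auto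
    next
      case 1
      then show ?thesis by (intro exI[of _ "[]"]) simp
    qed
  qed
  with that show thesis by blast
qed

text \<open>Consecutive copies of \<open>c\<close> meet in different factors, so nothing cancels.
  The power is therefore nonempty and uses only the letters of \<open>c\<close>.\<close>

lemma pow_cyclically_reduced:
  assumes "cyclically_reduced c"
  shows "c [^]\<^bsub>P\<^esub> Suc n = concat (replicate (Suc n) c)"
proof -
  have c: "c \<in> carrier P" "c \<noteq> []" "isl (hd c) \<noteq> isl (last c)"
    using assms by (auto simp: cyclically_reduced_def)
  have "c [^]\<^bsub>P\<^esub> Suc n = concat (replicate (Suc n) c) \<and> isl (hd (c [^]\<^bsub>P\<^esub> Suc n)) = isl (hd c)"
  proof (induction n)
    case (Suc n)
    let ?d = "c [^]\<^bsub>P\<^esub> Suc n"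
    have "c [^]\<^bsub>P\<^esub> Suc (Suc n) = c \<cdot> ?d"
      using P.nat_pow_Suc2[OF c(1)] by blast
    also have "\<dots> = c @ ?d"
      by (rule append_eq_mult) (use Suc c P.nat_pow_closed[OF c(1), of "Suc n"] in \<open>auto simp: append_closed_iff\<close>)
    finally show ?case using Suc c by simp
  qed (use c in simp)
  then show ?thesis ..
qed

text \<open>Truncation still gives an action of each factor: \<open>A\<close> permutes the words of length at most \<open>k\<close> that
  start in \<open>A\<close> or are shorter than \<open>k\<close>, and fixes the words of length \<open>k\<close> that start in \<open>B\<close>.\<close>

definition trunc_mult :: "nat \<Rightarrow> 'a + 'b \<Rightarrow> ('a + 'b) list \<Rightarrow> ('a + 'b) list" where
  "trunc_mult k x v = (if length (letter_mult A B x v) \<le> k then letter_mult A B x v else v)"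

lemma trunc_mult_Inl_mult:
  assumes "a \<in> carrier A" "a' \<in> carrier A" "v \<in> carrier P" "length v \<le> k"
  shows "trunc_mult k (Inl (a \<otimes>\<^bsub>A\<^esub> a')) v = trunc_mult k (Inl a) (trunc_mult k (Inl a') v)"
proof (cases "(v \<noteq> [] \<and> isl (hd v)) \<or> length v < k")
  case True
  \<comment> \<open>\<open>?good\<close> describes the words that left multiplication by
    \<open>A\<close> never makes too long. They form an invariant set on which truncation does
    nothing.\<close>
  let ?good = "\<lambda>v. length v \<le> k \<and> ((v \<noteq> [] \<and> isl (hd v)) \<or> length v < k)"
  have *: "trunc_mult k (Inl a) v = letter_mult A B (Inl a) v \<and> ?good (letter_mult A B (Inl a) v)"
    if "?good v" for a v
    using that
    by (cases v rule: word_cases_Inl) (auto simp: trunc_mult_def letter_mult_Inl_other)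
  have "?good v" using True assms(4) by blast
  then show ?thesis
    using assms letter_mult_Inl_Inl[OF A.is_group B.is_group assms(1,2)]
    by (simp add: * carrier_P)
next
  case False
  then have "length v = k" "v = [] \<or> \<not> isl (hd v)" using assms(4) by auto
  then have "trunc_mult k (Inl a) v = v" for a
    by (auto simp: trunc_mult_def letter_mult_Inl_other)
  then show ?thesis by simp
qed

lemma trunc_mult_Inr_mult:
  assumes "b \<in> carrier B" "b' \<in> carrier B" "v \<in> carrier P" "length v \<le> k"
  shows "trunc_mult k (Inr (b \<otimes>\<^bsub>B\<^esub> b')) v = trunc_mult k (Inr b) (trunc_mult k (Inr b') v)"
proof (cases "(v \<noteq> [] \<and> \<not> isl (hd v)) \<or> length v < k")
  case True
  let ?good = "\<lambda>v. length v \<le> k \<and> ((v \<noteq> [] \<and> \<not> isl (hd v)) \<or> length v < k)"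
  have *: "trunc_mult k (Inr b) v = letter_mult A B (Inr b) v \<and> ?good (letter_mult A B (Inr b) v)"
    if "?good v" for b v
    using that
    by (cases v rule: word_cases_Inr) (auto simp: trunc_mult_def letter_mult_Inr_other)
  have "?good v" using True assms(4) by blast
  then show ?thesis
    using assms letter_mult_Inr_Inr[OF A.is_group B.is_group assms(1,2)]
    by (simp add: * carrier_P)
next
  case False
  then have "length v = k" "v = [] \<or> isl (hd v)" using assms(4) by auto
  then have "trunc_mult k (Inr b) v = v" for b
    by (auto simp: trunc_mult_def letter_mult_Inr_other)
  then show ?thesis by simp
qed

lemma finite_words:
  assumes "finite (carrier A)" "finite (carrier B)"
  shows "finite {w \<in> carrier P. length w \<le> k}"
proof (rule finite_subset)
  let ?L = "Inl ` carrier A \<union> Inr ` carrier B"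
  show "{w \<in> carrier P. length w \<le> k} \<subseteq> {w. set w \<subseteq> ?L \<and> length w \<le> k}"
    by (auto simp: carrier_P reduced_words_def)
  show "finite {w. set w \<subseteq> ?L \<and> length w \<le> k}"
    using assms by (intro finite_lists_length_le) simp
qed

text \<open>\<open>P\<close> acts by truncated multiplication on the finitely many words of length
  at most that of \<open>g\<close>. There \<open>g\<close> moves the empty word to \<open>g\<close>
  itself, so it survives in a finite permutation group.\<close>

lemma residually_finite_finite_factors:
  assumes "finite (carrier A)" "finite (carrier B)"
  shows "residually_finite P"
  unfolding residually_finite_def
proof (intro ballI impI)
  fix g assume g: "g \<in> carrier P" "g \<noteq> \<one>\<^bsub>P\<^esub>"
  define k where "k = length g"
  define E where "E = {w \<in> carrier P. length w \<le> k}"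
  have A_closed: "trunc_mult k (Inl a) v \<in> E" if "a \<in> carrier A" "v \<in> E" for a v
    using that letter_mult_Inl_closed[OF A.is_group B.is_group, of a v]
    by (auto simp: E_def trunc_mult_def carrier_P)
  have B_closed: "trunc_mult k (Inr b) v \<in> E" if "b \<in> carrier B" "v \<in> E" for b v
    using that letter_mult_Inr_closed[OF A.is_group B.is_group, of b v]
    by (auto simp: E_def trunc_mult_def carrier_P)
  have one: "trunc_mult k (Inl \<one>\<^bsub>A\<^esub>) v = v" "trunc_mult k (Inr \<one>\<^bsub>B\<^esub>) v = v" if "v \<in> E" for v
    using that letter_mult_one[OF A.is_group B.is_group, of v]
    by (auto simp: E_def trunc_mult_def carrier_P)
  let ?f = "\<lambda>a. restrict (trunc_mult k (Inl a)) E"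
  let ?g = "\<lambda>b. restrict (trunc_mult k (Inr b)) E"
  have "?f \<in> hom A (BijGroup E)"
    by (rule hom_BijGroupI[OF A.is_group])
       (simp_all add: A_closed one trunc_mult_Inl_mult, simp add: E_def trunc_mult_Inl_mult)
  moreover have "?g \<in> hom B (BijGroup E)"
    by (rule hom_BijGroupI[OF B.is_group])
       (simp_all add: B_closed one trunc_mult_Inr_mult, simp add: E_def trunc_mult_Inr_mult)
  ultimately obtain h where h: "group_hom P (BijGroup E) h"
    "\<And>a. a \<in> carrier A \<Longrightarrow> h (\<iota>A a) = ?f a" "\<And>b. b \<in> carrier B \<Longrightarrow> h (\<iota>B b) = ?g b"
    using hom_extend[OF group_BijGroup] by blast
  interpret h: group_hom P "BijGroup E" h by fact
  have Nil_E: "[] \<in> E" by (simp add: E_def)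
  \<comment> \<open>Peeling off first letters builds \<open>w\<close> up from the empty word; all
    intermediate words are suffixes of \<open>w\<close>, hence short enough to escape
    truncation.\<close>
  have h_Nil: "h w [] = w" if "w \<in> E" for w
    using that
  proof (induction w)
    case Nil
    then show ?case using h.hom_one by (simp add: one_P BijGroup_def)
  next
    case (Cons x w)
    then have mem: "[x] \<in> carrier P" "w \<in> E" "w \<in> carrier P" "x # w \<in> carrier P" "length (x # w) \<le> k"
      using Cons_closed_iff[of x w] by (auto simp: E_def)
    have "h (x # w) = h [x] \<otimes>\<^bsub>BijGroup E\<^esub> h w"
      using mem Cons_eq_mult[of x w] by (simp flip: h.hom_mult)
    then have "h (x # w) [] = h [x] w"
      using mem Cons.IH Nil_E by (simp add: mult_BijGroup_apply)
    also have "\<dots> = trunc_mult k x w"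
    proof (cases x)
      case (Inl a)
      then show ?thesis using mem h(2)[of a] by (auto simp: \<iota>A_eq split: if_splits)
    next
      case (Inr b)
      then show ?thesis using mem h(3)[of b] by (auto simp: \<iota>B_eq split: if_splits)
    qed
    also have "\<dots> = x # w"
      using mem letter_mult_Cons[OF A.is_group B.is_group, of x w] by (simp add: trunc_mult_def carrier_P)
    finally show ?case .
  qed
  have "finite (carrier (BijGroup E))"
    unfolding E_def using finite_words[OF assms] by (rule finite_carrier_BijGroup)
  then have "finite (h ` carrier P)"
    by (rule finite_subset[rotated]) auto
  then have "finite_index_normal (kernel P (BijGroup E) h) P"
    by (rule finite_index_normal_kernel[OF h(1)])
  moreover have "g \<notin> kernel P (BijGroup E) h"
    using h_Nil[of g] h_Nil[of "[]"] g h.hom_one by (auto simp: kernel_def one_P k_def E_def)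
  ultimately show "\<exists>N. finite_index_normal N P \<and> g \<notin> N" by blast
qed

text \<open>The last property is the point: if no letter of \<open>w\<close> dies, neighbouring
  image letters still come from different factors, so the image is reduced and cannot
  collapse.\<close>

lemma hom_free_product_map:
  assumes "group A'" "group B'" "f \<in> hom A A'" "g \<in> hom B B'"
  obtains h where "group_hom P (free_product A' B') h"
    "\<And>a. a \<in> carrier A \<Longrightarrow> h (\<iota>A a) = free_product_groups.\<iota>A A' B' (f a)"
    "\<And>b. b \<in> carrier B \<Longrightarrow> h (\<iota>B b) = free_product_groups.\<iota>B A' B' (g b)"
    "\<And>w. w \<in> carrier P \<Longrightarrow> \<forall>a. Inl a \<in> set w \<longrightarrow> f a \<noteq> \<one>\<^bsub>A'\<^esub> \<Longrightarrow>
      \<forall>b. Inr b \<in> set w \<longrightarrow> g b \<noteq> \<one>\<^bsub>B'\<^esub> \<Longrightarrow> h w = map (map_sum f g) w"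
proof -
  interpret Q: free_product_groups A' B'
    using assms by (simp add: free_product_groups_def)
  have "(\<lambda>a. Q.\<iota>A (f a)) \<in> hom A Q.P" "(\<lambda>b. Q.\<iota>B (g b)) \<in> hom B Q.P"
    using hom_compose[OF assms(3) Q.\<iota>A.homh] hom_compose[OF assms(4) Q.\<iota>B.homh]
    by (simp_all add: comp_def)
  then obtain h where h: "group_hom P Q.P h" "\<And>a. a \<in> carrier A \<Longrightarrow> h (\<iota>A a) = Q.\<iota>A (f a)"
    "\<And>b. b \<in> carrier B \<Longrightarrow> h (\<iota>B b) = Q.\<iota>B (g b)"
    using hom_extend[OF Q.P.is_group] by blast
  interpret h: group_hom P Q.P h by fact
  have "h w = map (map_sum f g) w"
    if "w \<in> carrier P" "\<forall>a. Inl a \<in> set w \<longrightarrow> f a \<noteq> \<one>\<^bsub>A'\<^esub>"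
      "\<forall>b. Inr b \<in> set w \<longrightarrow> g b \<noteq> \<one>\<^bsub>B'\<^esub>" for w
    using that
  proof (induction w)
    case Nil
    then show ?case using h.hom_one by (simp add: one_P Q.one_P)
  next
    case (Cons x w)
    have mem: "[x] \<in> carrier P" "w \<in> carrier P" "w = [] \<or> isl x \<noteq> isl (hd w)"
      using Cons.prems(1) Cons_closed_iff[of x w] by auto
    have IH: "h w = map (map_sum f g) w"
      by (rule Cons.IH) (use mem Cons.prems in auto)
    have hx: "h [x] = [map_sum f g x]"
    proof (cases x)
      case (Inl a)
      then show ?thesis using mem h(2)[of a] Cons.prems by (auto simp: \<iota>A_eq Q.\<iota>A_eq)
    next
      case (Inr b)
      then show ?thesis using mem h(3)[of b] Cons.prems by (auto simp: \<iota>B_eq Q.\<iota>B_eq)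
    qed
    have isl: "isl (map_sum f g y) = isl y" for y by (cases y) auto
    have "map_sum f g x # map (map_sum f g) w \<in> carrier Q.P"
      using h.hom_closed[OF mem(1)] h.hom_closed[OF mem(2)] mem(3) hx IH
      by (subst Q.Cons_closed_iff) (auto simp: hd_map isl)
    from Q.Cons_eq_mult[OF this] show ?case
      using mem hx IH Cons_eq_mult[OF Cons.prems(1)] h.hom_mult[OF mem(1,2)] by simp
  qed
  with h that show thesis by blast
qed

end

section \<open>Automorphisms preserving the normal subgroups of finite index\<close>

text \<open>The condition of \<open>Aut_nf\<close> without extensionality, so that conjugates and
  composites need no restriction to the carrier.\<close>

definition normal_aut :: "('a, 'm) monoid_scheme \<Rightarrow> ('a \<Rightarrow> 'a) \<Rightarrow> bool" where
  "normal_aut G \<phi> \<longleftrightarrow> \<phi> \<in> iso G G \<and> (\<forall>N. finite_index_normal N G \<longrightarrow> \<phi> ` N = N)"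

lemma finite_imp_residually_finite:
  assumes "group G" "finite (carrier G)"
  shows "residually_finite G"
  unfolding residually_finite_def
proof (intro ballI impI)
  fix g assume "g \<in> carrier G" "g \<noteq> \<one>\<^bsub>G\<^esub>"
  moreover have "group_hom G G (\<lambda>x. x)"
    using assms(1) by (simp add: group_hom_def group_hom_axioms_def hom_def)
  then have "finite_index_normal (kernel G G (\<lambda>x. x)) G"
    using assms(2) by (intro finite_index_normal_kernel) simp_all
  ultimately show "\<exists>N. finite_index_normal N G \<and> g \<notin> N"
    by (auto simp: kernel_def)
qed

lemma normal_aut_mem_iff:
  assumes "normal_aut G \<phi>" "finite_index_normal N G" "x \<in> carrier G"
  shows "\<phi> x \<in> N \<longleftrightarrow> x \<in> N"
proof -
  have "\<phi> ` N = N" "inj_on \<phi> (carrier G)"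
    using assms by (auto simp: normal_aut_def iso_def bij_betw_def)
  moreover have "N \<subseteq> carrier G"
    using assms(2) normal_imp_subgroup subgroup.subset by (fastforce simp: finite_index_normal_def)
  ultimately show ?thesis
    using inj_on_image_mem_iff[of \<phi> "carrier G" x N] assms(3) by simp
qed

text \<open>The preimage is the kernel of \<open>h\<close> followed by the projection to the finite
  quotient by \<open>N\<close>.\<close>

lemma finite_index_normal_vimage:
  assumes "group_hom G H h" "finite_index_normal N H"
  shows "finite_index_normal {x \<in> carrier G. h x \<in> N} G"
proof -
  interpret h: group_hom G H h by fact
  interpret N: normal N H using assms(2) by (simp add: finite_index_normal_def)
  note Q = finite_index_normal_Mod[OF assms(2)]
  let ?h = "\<lambda>x. N #>\<^bsub>H\<^esub> h x"
  have hom: "group_hom G (H Mod N) ?h"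
    using Q hom_compose[OF h.homh Q(3)] h.G.is_group
    by (simp add: group_hom_def group_hom_axioms_def comp_def)
  have "finite (?h ` carrier G)"
    by (rule finite_subset[OF _ Q(2)]) (use group_hom.hom_closed[OF hom] in auto)
  from finite_index_normal_kernel[OF hom this] show ?thesis
    by (simp add: kernel_def N.r_coset_eq_self_iff cong: conj_cong)
qed

text \<open>In a residually finite group the unit is the only element common to all normal subgroups
  of finite index, and \<phi> respects the preimages of these.\<close>

lemma normal_aut_hom_one_iff:
  assumes "normal_aut G \<phi>" "group_hom G H h" "residually_finite H" "x \<in> carrier G"
  shows "h (\<phi> x) = \<one>\<^bsub>H\<^esub> \<longleftrightarrow> h x = \<one>\<^bsub>H\<^esub>"
proof -
  interpret h: group_hom G H h by fact
  have one_iff: "h y = \<one>\<^bsub>H\<^esub> \<longleftrightarrow> (\<forall>N. finite_index_normal N H \<longrightarrow> h y \<in> N)" if "y \<in> carrier G" for y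
    using assms(3) that h.hom_closed[OF that] subgroup.one_closed[OF normal_imp_subgroup]
    by (metis finite_index_normal_def residually_finite_def)
  have "\<phi> x \<in> carrier G"
    using assms by (auto simp: normal_aut_def iso_def hom_def)
  moreover have "h (\<phi> x) \<in> N \<longleftrightarrow> h x \<in> N" if "finite_index_normal N H" for N
    using normal_aut_mem_iff[OF assms(1) finite_index_normal_vimage[OF assms(2) that] assms(4)]
      assms(4) \<open>\<phi> x \<in> carrier G\<close> by simp
  ultimately show ?thesis
    using assms(4) by (simp add: one_iff)
qed

text \<open>Preservation of the kernel of \<open>h\<close>, applied to a quotient of two elements.
  This is how relations valid in the image of \<open>h\<close> are transported along \<phi>.\<close>

lemma normal_aut_hom_eq:
  assumes "normal_aut G \<phi>" "group_hom G H h" "residually_finite H" "x \<in> carrier G" "y \<in> carrier G"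
    and "h x = h y"
  shows "h (\<phi> x) = h (\<phi> y)"
proof -
  interpret h: group_hom G H h by fact
  interpret \<phi>: group_hom G G \<phi>
    using assms(1) h.G.is_group by (simp add: normal_aut_def iso_def group_hom_def group_hom_axioms_def)
  have "h (\<phi> (x \<otimes>\<^bsub>G\<^esub> inv\<^bsub>G\<^esub> y)) = \<one>\<^bsub>H\<^esub>"
    using assms(4-6) normal_aut_hom_one_iff[OF assms(1-3), of "x \<otimes>\<^bsub>G\<^esub> inv\<^bsub>G\<^esub> y"] by simp
  then have "h (\<phi> x) \<otimes>\<^bsub>H\<^esub> inv\<^bsub>H\<^esub> h (\<phi> y) = \<one>\<^bsub>H\<^esub>"
    using assms(4,5) by simp
  then show ?thesis
    using assms(4,5) h.H.inv_solve_right'[of "\<one>\<^bsub>H\<^esub>" "h (\<phi> x)" "h (\<phi> y)"] by simp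
qed

lemma normal_aut_conj:
  assumes "group G" "normal_aut G \<phi>" "g \<in> carrier G"
  shows "normal_aut G (\<lambda>x. g \<otimes>\<^bsub>G\<^esub> \<phi> x \<otimes>\<^bsub>G\<^esub> inv\<^bsub>G\<^esub> g)"
proof -
  interpret G: group G by fact
  let ?c = "\<lambda>x. g \<otimes>\<^bsub>G\<^esub> x \<otimes>\<^bsub>G\<^esub> inv\<^bsub>G\<^esub> g"
  have c: "?c \<in> iso G G"
  proof (rule isoI)
    show "?c \<in> hom G G"
      using assms(3) by (intro homI) (simp_all add: G.m_assoc G.inv_mult_cancel)
    show "bij_betw ?c (carrier G) (carrier G)"
      by (rule bij_betw_byWitness[of _ "\<lambda>x. inv\<^bsub>G\<^esub> g \<otimes>\<^bsub>G\<^esub> x \<otimes>\<^bsub>G\<^esub> g"])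
         (use assms(3) in \<open>auto simp: G.m_assoc G.inv_mult_cancel\<close>)
  qed
  have "(\<lambda>x. ?c (\<phi> x)) ` N = N" if N: "finite_index_normal N G" for N
  proof -
    interpret N: normal N G using N by (simp add: finite_index_normal_def)
    have "?c ` N = N"
    proof
      show "?c ` N \<subseteq> N" using N.inv_op_closed2[OF assms(3)] by auto
      show "N \<subseteq> ?c ` N"
      proof
        fix x assume x: "x \<in> N"
        then have "x = ?c (inv\<^bsub>G\<^esub> g \<otimes>\<^bsub>G\<^esub> x \<otimes>\<^bsub>G\<^esub> g)"
          using assms(3) N.mem_carrier[OF x] by (simp add: G.m_assoc G.inv_mult_cancel)
        with N.inv_op_closed1[OF assms(3) x] show "x \<in> ?c ` N" by blast
      qed
    qed
    moreover have "(\<lambda>x. ?c (\<phi> x)) ` N = ?c ` \<phi> ` N" by (rule image_image[symmetric])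
    ultimately show ?thesis
      using assms(2) N by (simp only: normal_aut_def)
  qed
  moreover have "(\<lambda>x. ?c (\<phi> x)) \<in> iso G G"
    using iso_set_trans[OF _ c, of \<phi> G] assms(2) by (simp add: normal_aut_def comp_def)
  ultimately show ?thesis by (simp add: normal_aut_def)
qed

section \<open>The images of the factors\<close>

locale residually_finite_factors = free_product_groups A B
  for A :: "('a, 'm) monoid_scheme" and B :: "('b, 'n) monoid_scheme" +
  assumes rf_A: "residually_finite A" and rf_B: "residually_finite B"
begin

lemma normal_aut_hom:
  assumes "normal_aut P \<phi>"
  shows "group_hom P P \<phi>"
  using assms P.is_group by (simp add: normal_aut_def iso_def group_hom_def group_hom_axioms_def)

lemma normal_aut_not_conj_cyclically_reduced:
  assumes \<phi>: "normal_aut P \<phi>" and w: "w \<in> factor s" and c: "cyclically_reduced c"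
    and u: "u \<in> carrier P"
  shows "\<phi> w \<noteq> u \<cdot> c \<cdot> inv\<^bsub>P\<^esub> u"
proof
  assume eq: "\<phi> w = u \<cdot> c \<cdot> inv\<^bsub>P\<^esub> u"
  interpret \<phi>: group_hom P P \<phi> using \<phi> by (rule normal_aut_hom)
  have cP: "c \<in> carrier P" and "c \<noteq> []" using c by (simp_all add: cyclically_reduced_def)
  note wP = factor_closed[OF w]
  let ?SA = "{a. Inl a \<in> set c}" and ?SB = "{b. Inr b \<in> set c}"
  have "finite ?SA" "finite ?SB"
    by (simp_all add: finite_vimageI[of "set c", unfolded vimage_def])
  moreover have "?SA \<subseteq> carrier A - {\<one>\<^bsub>A\<^esub>}" "?SB \<subseteq> carrier B - {\<one>\<^bsub>B\<^esub>}"
    using cP by (auto simp: carrier_P reduced_words_def)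
  ultimately have SA: "finite ?SA" "?SA \<subseteq> carrier A - {\<one>\<^bsub>A\<^esub>}"
    and SB: "finite ?SB" "?SB \<subseteq> carrier B - {\<one>\<^bsub>B\<^esub>}" by simp_all
  obtain A' :: "'a set monoid" and f where f: "group A'" "finite (carrier A')" "f \<in> hom A A'"
    "\<forall>a\<in>?SA. f a \<noteq> \<one>\<^bsub>A'\<^esub>"
    using residually_finite_hom[OF A.is_group rf_A SA] .
  obtain B' :: "'b set monoid" and g where g: "group B'" "finite (carrier B')" "g \<in> hom B B'"
    "\<forall>b\<in>?SB. g b \<noteq> \<one>\<^bsub>B'\<^esub>"
    using residually_finite_hom[OF B.is_group rf_B SB] .
  interpret Q: free_product_groups A' B'
    using f g by (simp add: free_product_groups_def)
  obtain h where h: "group_hom P Q.P h"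
    "\<And>a. a \<in> carrier A \<Longrightarrow> h (\<iota>A a) = Q.\<iota>A (f a)"
    "\<And>b. b \<in> carrier B \<Longrightarrow> h (\<iota>B b) = Q.\<iota>B (g b)"
    "\<And>w. w \<in> carrier P \<Longrightarrow> \<forall>a. Inl a \<in> set w \<longrightarrow> f a \<noteq> \<one>\<^bsub>A'\<^esub> \<Longrightarrow>
      \<forall>b. Inr b \<in> set w \<longrightarrow> g b \<noteq> \<one>\<^bsub>B'\<^esub> \<Longrightarrow> h w = map (map_sum f g) w"
    by (rule hom_free_product_map[OF f(1) g(1) f(3) g(3)], erule that, simp_all)
  interpret h: group_hom P Q.P h by fact
  \<comment> \<open>A common multiple of both orders kills \<open>h w\<close> whichever factor
    contains \<open>w\<close>. It is positive, so the power of \<open>c\<close> with this exponent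
    is not empty.\<close>
  define m where "m = order A' * order B'"
  have "m > 0"
    using f g Q.A.order_gt_0_iff_finite Q.B.order_gt_0_iff_finite by (simp add: m_def)
  then obtain n where n: "m = Suc n" using gr0_implies_Suc by blast
  have "h w [^]\<^bsub>Q.P\<^esub> m = \<one>\<^bsub>Q.P\<^esub>"
  proof (cases s)
    case True
    then obtain a where a: "a \<in> carrier A" "w = \<iota>A a" using w by (auto simp: factor_eq)
    have fa: "f a \<in> carrier A'" using f(3) a by (auto simp: hom_def)
    have "f a [^]\<^bsub>A'\<^esub> m = (f a [^]\<^bsub>A'\<^esub> order A') [^]\<^bsub>A'\<^esub> order B'"
      using fa by (simp add: Q.A.nat_pow_pow m_def)
    then have "f a [^]\<^bsub>A'\<^esub> m = \<one>\<^bsub>A'\<^esub>"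
      using fa by (simp add: Q.A.pow_order_eq_1)
    then show ?thesis
      using a h(2)[of a] fa Q.\<iota>A.hom_nat_pow[OF fa, of m] by simp
  next
    case False
    then obtain b where b: "b \<in> carrier B" "w = \<iota>B b" using w by (auto simp: factor_eq)
    have gb: "g b \<in> carrier B'" using g(3) b by (auto simp: hom_def)
    have "g b [^]\<^bsub>B'\<^esub> m = (g b [^]\<^bsub>B'\<^esub> order B') [^]\<^bsub>B'\<^esub> order A'"
      using gb by (simp add: Q.B.nat_pow_pow m_def mult.commute)
    then have "g b [^]\<^bsub>B'\<^esub> m = \<one>\<^bsub>B'\<^esub>"
      using gb by (simp add: Q.B.pow_order_eq_1)
    then show ?thesis
      using b h(3)[of b] gb Q.\<iota>B.hom_nat_pow[OF gb, of m] by simp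
  qed
  then have "h (w [^]\<^bsub>P\<^esub> m) = \<one>\<^bsub>Q.P\<^esub>"
    using h.hom_nat_pow[OF wP] by simp
  then have "h (\<phi> (w [^]\<^bsub>P\<^esub> m)) = \<one>\<^bsub>Q.P\<^esub>"
    using normal_aut_hom_one_iff[OF \<phi> h(1) Q.residually_finite_finite_factors[OF f(2) g(2)]] wP
    by simp
  moreover have "\<phi> (w [^]\<^bsub>P\<^esub> m) = u \<cdot> c [^]\<^bsub>P\<^esub> m \<cdot> inv\<^bsub>P\<^esub> u"
    using wP u cP by (simp add: \<phi>.hom_nat_pow eq P.pow_conj)
  ultimately have "h u \<otimes>\<^bsub>Q.P\<^esub> h (c [^]\<^bsub>P\<^esub> m) \<otimes>\<^bsub>Q.P\<^esub> inv\<^bsub>Q.P\<^esub> h u = \<one>\<^bsub>Q.P\<^esub>"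
    using u cP by simp
  then have "h u \<otimes>\<^bsub>Q.P\<^esub> h (c [^]\<^bsub>P\<^esub> m) = h u"
    using u cP Q.P.inv_solve_right'[of "\<one>\<^bsub>Q.P\<^esub>" "h u \<otimes>\<^bsub>Q.P\<^esub> h (c [^]\<^bsub>P\<^esub> m)" "h u"] by simp
  then have "h (c [^]\<^bsub>P\<^esub> m) = \<one>\<^bsub>Q.P\<^esub>"
    using u cP by (simp add: Q.P.r_cancel_one)
  \<comment> \<open>A power of \<open>c\<close> has no letters beyond those of \<open>c\<close>, all
    of which survive, so \<open>h\<close> acts on it letter by letter.\<close>
  moreover have "set (c [^]\<^bsub>P\<^esub> m) = set c"
    unfolding n pow_cyclically_reduced[OF c] by auto
  then have "h (c [^]\<^bsub>P\<^esub> m) = map (map_sum f g) (c [^]\<^bsub>P\<^esub> m)"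
    using f(4) g(4) cP by (intro h(4)) auto
  moreover have "c [^]\<^bsub>P\<^esub> m \<noteq> []"
    unfolding n pow_cyclically_reduced[OF c] using \<open>c \<noteq> []\<close> by simp
  ultimately show False by (simp add: Q.one_P)
qed

text \<open>Killing the other factor is a retraction onto a residually finite group.\<close>

lemma normal_aut_not_conj_other_factor:
  assumes \<phi>: "normal_aut P \<phi>" and w: "w \<in> factor s" and c: "c \<in> factor (\<not> s)"
    and u: "u \<in> carrier P" and eq: "\<phi> w = u \<cdot> c \<cdot> inv\<^bsub>P\<^esub> u"
  shows "w = []"
proof (cases s)
  case True
  obtain h where h: "group_hom P A h" "\<And>a. a \<in> carrier A \<Longrightarrow> h (\<iota>A a) = a"
    "\<And>b. b \<in> carrier B \<Longrightarrow> h (\<iota>B b) = \<one>\<^bsub>A\<^esub>"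
    using hom_extend[OF A.is_group, of "\<lambda>a. a" "\<lambda>_. \<one>\<^bsub>A\<^esub>"] by (auto simp: hom_def)
  interpret h: group_hom P A h by fact
  obtain a where a: "a \<in> carrier A" "w = \<iota>A a" using w True by (auto simp: factor_eq)
  have "h c = \<one>\<^bsub>A\<^esub>" using c True h(3) by (auto simp: factor_eq)
  then have "h (\<phi> w) = \<one>\<^bsub>A\<^esub>" using factor_closed[OF c] u by (simp add: eq)
  then have "h w = \<one>\<^bsub>A\<^esub>" using normal_aut_hom_one_iff[OF \<phi> h(1) rf_A factor_closed[OF w]] by simp
  with a h(2) show ?thesis by (simp add: \<iota>A_eq)
next
  case False
  obtain h where h: "group_hom P B h" "\<And>a. a \<in> carrier A \<Longrightarrow> h (\<iota>A a) = \<one>\<^bsub>B\<^esub>"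
    "\<And>b. b \<in> carrier B \<Longrightarrow> h (\<iota>B b) = b"
    using hom_extend[OF B.is_group, of "\<lambda>_. \<one>\<^bsub>B\<^esub>" "\<lambda>b. b"] by (auto simp: hom_def)
  interpret h: group_hom P B h by fact
  obtain b where b: "b \<in> carrier B" "w = \<iota>B b" using w False by (auto simp: factor_eq)
  have "h c = \<one>\<^bsub>B\<^esub>" using c False h(2) by (auto simp: factor_eq)
  then have "h (\<phi> w) = \<one>\<^bsub>B\<^esub>" using factor_closed[OF c] u by (simp add: eq)
  then have "h w = \<one>\<^bsub>B\<^esub>" using normal_aut_hom_one_iff[OF \<phi> h(1) rf_B factor_closed[OF w]] by simp
  with b h(3) show ?thesis by (simp add: \<iota>B_eq)
qed

text \<open>After cyclically reduced words are excluded, only conjugates of factor elements remain.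
  The wrong factor can occur for the trivial \<open>w\<close> alone, where the unit serves as
  \<open>c\<close>. On the Bass-Serre tree such elements fix a vertex, whence the name.\<close>

lemma normal_aut_elliptic:
  assumes \<phi>: "normal_aut P \<phi>" and w: "w \<in> factor s"
  obtains u c where "u \<in> carrier P" "c \<in> factor s" "\<phi> w = u \<cdot> c \<cdot> inv\<^bsub>P\<^esub> u"
proof -
  interpret \<phi>: group_hom P P \<phi> using \<phi> by (rule normal_aut_hom)
  obtain u c where u: "u \<in> carrier P" "c \<in> carrier P" "\<phi> w = u \<cdot> c \<cdot> inv\<^bsub>P\<^esub> u"
    "cyclically_reduced c \<or> (\<exists>s. c \<in> factor s)"
    using conj_cyclically_reduced[OF \<phi>.hom_closed[OF factor_closed[OF w]]] .
  with normal_aut_not_conj_cyclically_reduced[OF \<phi> w, of c u]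
  obtain t where t: "c \<in> factor t" by blast
  show thesis
  proof (cases "t = s")
    case False
    then have "w = []"
      using normal_aut_not_conj_other_factor[OF \<phi> w _ u(1,3)] t by simp
    then show thesis
      using \<phi>.hom_one by (intro that[of "[]" "[]"]) (simp_all add: one_P)
  qed (use that u t in blast)
qed

text \<open>So far each image has its own conjugator. That of one nontrivial image serves all:
  otherwise a product of two images would be conjugate to a cyclically reduced word, although it is
  the image of a single factor element.\<close>

lemma normal_aut_factor_conj:
  assumes \<phi>: "normal_aut P \<phi>"
  obtains g where "g \<in> carrier P"
    "\<And>w. w \<in> factor s \<Longrightarrow> \<exists>c\<in>factor s. \<phi> w = g \<cdot> c \<cdot> inv\<^bsub>P\<^esub> g"
proof (cases "\<exists>w\<in>factor s. \<phi> w \<noteq> []")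
  \<comment> \<open>All images are trivial, which by injectivity means a trivial factor, and any
    conjugator will do.\<close>
  case False
  then show thesis
    by (intro that[of "[]"]) (auto intro!: bexI[of _ "[]"])
next
  case True
  interpret \<phi>: group_hom P P \<phi> using \<phi> by (rule normal_aut_hom)
  obtain w1 where w1: "w1 \<in> factor s" "\<phi> w1 \<noteq> []" using True by blast
  obtain g c1 where g: "g \<in> carrier P" and c1: "c1 \<in> factor s" and eq1: "\<phi> w1 = g \<cdot> c1 \<cdot> inv\<^bsub>P\<^esub> g"
    using normal_aut_elliptic[OF \<phi> w1(1)] .
  note c1P = factor_closed[OF c1]
  have c1_ne: "c1 \<noteq> []" using w1 g P.r_inv[OF g] eq1 by (auto simp: one_P)
  show thesis
  proof (rule that[OF g])
    fix w2 assume w2: "w2 \<in> factor s"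
    obtain u c2 where u: "u \<in> carrier P" and c2: "c2 \<in> factor s" and eq2: "\<phi> w2 = u \<cdot> c2 \<cdot> inv\<^bsub>P\<^esub> u"
      using normal_aut_elliptic[OF \<phi> w2] .
    note c2P = factor_closed[OF c2]
    \<comment> \<open>\<open>v\<close> measures how far the two conjugates of the factor are apart;
      it is empty when \<open>g\<close> and \<open>u\<close> differ only by a factor
      element.\<close>
    obtain p v q where p: "p \<in> factor s" and q: "q \<in> factor s" and vP: "v \<in> carrier P"
      and gu: "inv\<^bsub>P\<^esub> g \<cdot> u = p \<cdot> v \<cdot> q"
      and v: "v = [] \<or> isl (hd v) \<noteq> s \<and> isl (last v) \<noteq> s"
      by (rule strip_both[of "inv\<^bsub>P\<^esub> g \<cdot> u" s s]) (use g u in simp)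
    note pP = factor_closed[OF p] and qP = factor_closed[OF q]
    have u_eq: "u = g \<cdot> p \<cdot> v \<cdot> q"
      using gu g u pP qP vP by (simp add: P.m_assoc P.inv_solve_left')
    define d1 where "d1 = inv\<^bsub>P\<^esub> p \<cdot> c1 \<cdot> p"
    define d2 where "d2 = q \<cdot> c2 \<cdot> inv\<^bsub>P\<^esub> q"
    have d: "d1 \<in> factor s" "d2 \<in> factor s" using p q c1 c2 by (simp_all add: d1_def d2_def)
    note dP = factor_closed[OF d(1)] factor_closed[OF d(2)]
    have eq2': "\<phi> w2 = g \<cdot> p \<cdot> (v \<cdot> d2 \<cdot> inv\<^bsub>P\<^esub> v) \<cdot> inv\<^bsub>P\<^esub> (g \<cdot> p)"
      using g pP qP vP c2P by (simp add: eq2 u_eq d2_def P.m_assoc P.inv_mult_group)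
    show "\<exists>c\<in>factor s. \<phi> w2 = g \<cdot> c \<cdot> inv\<^bsub>P\<^esub> g"
    \<comment> \<open>Either the two conjugates coincide or \<open>\<phi> w2\<close> is trivial; in
      both cases \<open>g\<close> works.\<close>
    proof (cases "v = [] \<or> d2 = []")
      case True
      then have "v \<cdot> d2 \<cdot> inv\<^bsub>P\<^esub> v = d2"
        using vP dP P.r_inv[OF vP] by (auto simp: one_P)
      then have "\<phi> w2 = g \<cdot> (p \<cdot> d2 \<cdot> inv\<^bsub>P\<^esub> p) \<cdot> inv\<^bsub>P\<^esub> g"
        using g pP dP by (simp add: eq2' P.m_assoc P.inv_mult_group)
      then show ?thesis using p d by (intro bexI[of _ "p \<cdot> d2 \<cdot> inv\<^bsub>P\<^esub> p"]) simp_all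
    next
      case False
      have "d1 \<noteq> []"
      proof
        assume "d1 = []"
        moreover have "c1 = p \<cdot> d1 \<cdot> inv\<^bsub>P\<^esub> p"
          using pP c1P by (simp add: d1_def P.m_assoc P.inv_mult_cancel)
        ultimately show False using c1_ne pP P.r_inv[OF pP] by (simp add: one_P)
      qed
      then have ends: "d1 \<noteq> []" "isl (hd d1) = s" "isl (last d1) = s"
        "d2 \<noteq> []" "isl (hd d2) = s" "isl (last d2) = s"
        using d False by (auto elim!: factor_cases)
      \<comment> \<open>\<open>d1\<close> and \<open>d2\<close> lie in factor \<open>s\<close>,
        while \<open>v\<close> and its inverse begin and end outside it. So every junction changes
        factor, and the two ends of the whole word differ as well.\<close>
      let ?c = "d1 @ v @ d2 @ inv\<^bsub>P\<^esub> v"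
      note iv = inv_ends[OF vP]
      have mem: "d2 @ inv\<^bsub>P\<^esub> v \<in> carrier P" "v @ d2 @ inv\<^bsub>P\<^esub> v \<in> carrier P" "?c \<in> carrier P"
        using vP dP iv v False ends by (auto simp: append_closed_iff)
      have c_eq: "?c = d1 \<cdot> (v \<cdot> (d2 \<cdot> inv\<^bsub>P\<^esub> v))"
        using mem by (simp add: append_eq_mult)
      have "cyclically_reduced ?c"
        using mem(3) iv v False ends by (simp add: cyclically_reduced_def)
      moreover have "\<phi> (w1 \<cdot> w2) = (g \<cdot> p) \<cdot> ?c \<cdot> inv\<^bsub>P\<^esub> (g \<cdot> p)"
      proof -
        have "\<phi> w1 = g \<cdot> p \<cdot> d1 \<cdot> inv\<^bsub>P\<^esub> (g \<cdot> p)"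
          using g pP c1P by (simp add: eq1 d1_def P.m_assoc P.inv_mult_group P.inv_mult_cancel)
        then have "\<phi> (w1 \<cdot> w2) = (g \<cdot> p \<cdot> d1 \<cdot> inv\<^bsub>P\<^esub> (g \<cdot> p)) \<cdot>
            (g \<cdot> p \<cdot> (v \<cdot> d2 \<cdot> inv\<^bsub>P\<^esub> v) \<cdot> inv\<^bsub>P\<^esub> (g \<cdot> p))"
          using \<phi>.hom_mult[OF factor_closed[OF w1(1)] factor_closed[OF w2]] by (simp only: eq2')
        also have "\<dots> = (g \<cdot> p) \<cdot> ?c \<cdot> inv\<^bsub>P\<^esub> (g \<cdot> p)"
          unfolding c_eq using g pP dP vP
          by (simp add: P.m_assoc P.inv_mult_group P.inv_mult_cancel)
        finally show ?thesis .
      qed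
      ultimately have False
        using normal_aut_not_conj_cyclically_reduced[OF \<phi> factor_mult[OF w1(1) w2], of ?c "g \<cdot> p"] g pP
        by simp
      then show ?thesis ..
    qed
  qed
qed

section \<open>Matching the conjugators of the two factors\<close>

text \<open>A nonempty \<open>K\<close> begins in \<open>B\<close> and ends in \<open>A\<close>, so
  letters of \<open>B\<close> get images of length at least 3 with both ends in \<open>B\<close>,
  while letters of \<open>A\<close> stay letters of \<open>A\<close>. Images of the letters of a
  reduced word then concatenate without cancellation, no single letter of \<open>B\<close> is
  attained, and surjectivity fails.\<close>

lemma conjugator_of_factor_images_trivial:
  assumes \<psi>: "normal_aut P \<psi>" and K: "K \<in> carrier P"
    and A_img: "\<And>w. w \<in> factor True \<Longrightarrow> \<psi> w \<in> factor True"
    and B_img: "\<And>w. w \<in> factor False \<Longrightarrow> \<exists>c\<in>factor False. \<psi> w = K \<cdot> c \<cdot> inv\<^bsub>P\<^esub> K"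
    and ends: "K = [] \<or> \<not> isl (hd K) \<and> isl (last K)"
  shows "K = []"
proof (rule ccontr)
  assume "K \<noteq> []"
  interpret \<psi>: group_hom P P \<psi> using \<psi> by (rule normal_aut_hom)
  have bij: "bij_betw \<psi> (carrier P) (carrier P)"
    using \<psi> by (simp add: normal_aut_def iso_def)
  have inj: "\<psi> w \<noteq> []" if "w \<in> carrier P" "w \<noteq> []" for w
    using bij_betw_imp_inj_on[OF bij] that inj_onD[of \<psi> "carrier P" w "[]"] \<psi>.hom_one
    by (auto simp: one_P)
  note iv = inv_ends[OF K \<open>K \<noteq> []\<close>]
  have letter: "isl (hd (\<psi> [x])) = isl x \<and> isl (last (\<psi> [x])) = isl x \<and> (\<not> isl x \<longrightarrow> 3 \<le> length (\<psi> [x]))"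
    if x: "[x] \<in> carrier P" for x
  proof (cases "isl x")
    case True
    then have "\<psi> [x] \<in> factor True" using A_img[OF singleton_factor[OF x]] by simp
    then show ?thesis using inj[OF x] True by (auto elim!: factor_cases)
  next
    case False
    then obtain c where c: "c \<in> factor False" "\<psi> [x] = K \<cdot> c \<cdot> inv\<^bsub>P\<^esub> K"
      using B_img[OF singleton_factor[OF x]] by blast
    have "c \<noteq> []"
      using inj[OF x] c K P.r_inv[OF K] by (auto simp: one_P)
    then have c': "\<not> isl (hd c)" "\<not> isl (last c)" using c by (auto elim!: factor_cases)
    have mem: "c @ inv\<^bsub>P\<^esub> K \<in> carrier P" "K @ c @ inv\<^bsub>P\<^esub> K \<in> carrier P"
      using K factor_closed[OF c(1)] iv c' ends \<open>c \<noteq> []\<close> \<open>K \<noteq> []\<close> by (auto simp: append_closed_iff)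
    then have "\<psi> [x] = K @ c @ inv\<^bsub>P\<^esub> K"
      using K factor_closed[OF c(1)] by (simp add: c(2) P.m_assoc append_eq_mult)
    moreover have "3 \<le> length (K @ c @ inv\<^bsub>P\<^esub> K)"
      using \<open>c \<noteq> []\<close> \<open>K \<noteq> []\<close> iv by (cases K; cases c; cases "inv\<^bsub>P\<^esub> K") auto
    ultimately show ?thesis using \<open>K \<noteq> []\<close> iv ends False by simp
  qed
  have word: "isl (hd (\<psi> w)) = isl (hd w) \<and> (\<not> isl (hd w) \<longrightarrow> 3 \<le> length (\<psi> w))"
    if "w \<in> carrier P" "w \<noteq> []" for w
    using that
  proof (induction w)
    case (Cons x w)
    then have mem: "[x] \<in> carrier P" "w \<in> carrier P" "w = [] \<or> isl x \<noteq> isl (hd w)"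
      using Cons_closed_iff[of x w] by auto
    have x: "\<psi> [x] \<noteq> []" using inj[OF mem(1)] by simp
    have "\<psi> (x # w) = \<psi> [x] \<cdot> \<psi> w"
      using \<psi>.hom_mult[OF mem(1,2)] Cons_eq_mult[OF Cons.prems(1)] by simp
    also have "\<dots> = \<psi> [x] @ \<psi> w"
    proof (rule append_eq_mult, unfold append_closed_iff, intro conjI)
      show "\<psi> [x] \<in> carrier P" "\<psi> w \<in> carrier P" using mem by simp_all
      show "\<psi> [x] = [] \<or> \<psi> w = [] \<or> isl (last (\<psi> [x])) \<noteq> isl (hd (\<psi> w))"
      proof (cases "w = []")
        case True
        then show ?thesis using \<psi>.hom_one by (simp add: one_P)
      next
        case False
        then show ?thesis using Cons.IH mem letter[OF mem(1)] by simp
      qed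
    qed
    finally show ?case using letter[OF mem(1)] x by auto
  qed simp
  \<comment> \<open>The first letter of \<open>K\<close> is a letter of \<open>B\<close>, so by
    \<open>word\<close> it cannot be an image.\<close>
  have y: "[hd K] \<in> carrier P"
    using K \<open>K \<noteq> []\<close> Cons_closed_iff[of "hd K" "tl K"] by simp
  then obtain w where w: "w \<in> carrier P" "\<psi> w = [hd K]"
    using bij_betw_imp_surj_on[OF bij] by (metis imageE)
  then have "w \<noteq> []" using \<psi>.hom_one by (auto simp: one_P)
  with word[OF w(1)] w ends \<open>K \<noteq> []\<close> show False by simp
qed

lemma normal_aut_factors_up_to_conj:
  assumes \<phi>: "normal_aut P \<phi>"
  obtains g where "g \<in> carrier P" "normal_aut P (\<lambda>x. g \<cdot> \<phi> x \<cdot> inv\<^bsub>P\<^esub> g)"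
    "\<And>s w. w \<in> factor s \<Longrightarrow> g \<cdot> \<phi> w \<cdot> inv\<^bsub>P\<^esub> g \<in> factor s"
proof -
  obtain k1 where k1: "k1 \<in> carrier P"
    and img1: "\<And>w. w \<in> factor True \<Longrightarrow> \<exists>c\<in>factor True. \<phi> w = k1 \<cdot> c \<cdot> inv\<^bsub>P\<^esub> k1"
    by (rule normal_aut_factor_conj[OF \<phi>, of True]) blast
  obtain k2 where k2: "k2 \<in> carrier P"
    and img2: "\<And>w. w \<in> factor False \<Longrightarrow> \<exists>c\<in>factor False. \<phi> w = k2 \<cdot> c \<cdot> inv\<^bsub>P\<^esub> k2"
    by (rule normal_aut_factor_conj[OF \<phi>, of False]) blast
  \<comment> \<open>\<open>k1\<close> and \<open>k2\<close> may each be changed on the right by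
    elements of their own factor; \<open>K\<close> is what remains of their quotient after
    this.\<close>
  obtain p K q where p: "p \<in> factor True" and q: "q \<in> factor False" and K: "K \<in> carrier P"
    and eq: "inv\<^bsub>P\<^esub> k1 \<cdot> k2 = p \<cdot> K \<cdot> q" and ends: "K = [] \<or> isl (hd K) \<noteq> True \<and> isl (last K) \<noteq> False"
    by (rule strip_both[of "inv\<^bsub>P\<^esub> k1 \<cdot> k2" True False]) (use k1 k2 in simp)
  note pP = factor_closed[OF p] and qP = factor_closed[OF q]
  \<comment> \<open>Conjugation by \<open>g\<close> brings the images of \<open>A\<close> back into
    \<open>A\<close> and those of \<open>B\<close> into the conjugate of \<open>B\<close> by
    \<open>K\<close>.\<close>
  define g where "g = inv\<^bsub>P\<^esub> (k1 \<cdot> p)"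
  have g: "g \<in> carrier P" using k1 pP by (simp add: g_def)
  let ?\<psi> = "\<lambda>x. g \<cdot> \<phi> x \<cdot> inv\<^bsub>P\<^esub> g"
  have \<psi>: "normal_aut P ?\<psi>" by (rule normal_aut_conj[OF P.is_group \<phi> g])
  have A_img: "?\<psi> w \<in> factor True" if "w \<in> factor True" for w
  proof -
    obtain c where c: "c \<in> factor True" "\<phi> w = k1 \<cdot> c \<cdot> inv\<^bsub>P\<^esub> k1" using img1[OF \<open>w \<in> factor True\<close>] by blast
    have "?\<psi> w = inv\<^bsub>P\<^esub> p \<cdot> c \<cdot> p"
      using k1 pP factor_closed[OF c(1)]
      by (simp add: c(2) g_def P.m_assoc P.inv_mult_group P.inv_mult_cancel)
    then show ?thesis using p c by simp
  qed
  have k2_eq: "k2 = k1 \<cdot> p \<cdot> K \<cdot> q"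
    using eq k1 k2 pP qP K by (simp add: P.m_assoc P.inv_solve_left')
  have B_img: "\<exists>c\<in>factor False. ?\<psi> w = K \<cdot> c \<cdot> inv\<^bsub>P\<^esub> K" if "w \<in> factor False" for w
  proof -
    obtain c where c: "c \<in> factor False" "\<phi> w = k2 \<cdot> c \<cdot> inv\<^bsub>P\<^esub> k2" using img2[OF \<open>w \<in> factor False\<close>] by blast
    have "?\<psi> w = K \<cdot> (q \<cdot> c \<cdot> inv\<^bsub>P\<^esub> q) \<cdot> inv\<^bsub>P\<^esub> K"
      using k1 pP qP K factor_closed[OF c(1)]
      by (simp add: c(2) k2_eq g_def P.m_assoc P.inv_mult_group P.inv_mult_cancel)
    then show ?thesis using q c by (intro bexI[of _ "q \<cdot> c \<cdot> inv\<^bsub>P\<^esub> q"]) simp_all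
  qed
  have "K = []"
    by (rule conjugator_of_factor_images_trivial[OF \<psi> K A_img B_img]) (use ends in auto)
  then have "?\<psi> w \<in> factor s" if "w \<in> factor s" for s w
    using A_img[of w] B_img[of w] that by (cases s) (auto dest: factor_closed)
  with g \<psi> show thesis by (intro that)
qed

end

section \<open>A relation detecting single elements\<close>

text \<open>This arithmetic makes the relation fail at \<open>a'\<close>: the exponents 0 and 1,
  where the congruence can hold, will belong to \<open>a'\<close> trivial and \<open>a'\<close>
  equal to \<open>a\<close>. Both sides are reduced below the modulus and then compared modulo
  9.\<close>

lemma not_cong_pow3:
  fixes z :: int
  assumes "2 \<le> k" "k < n" and z: "z = 0 \<or> (\<exists>j<n. z = 3 ^ j)"
  shows "\<not> [4 * 3 ^ k = 3 + z] (mod (3 ^ n - 1))"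
proof
  assume cong: "[4 * 3 ^ k = 3 + z] (mod (3 ^ n - 1))"
  obtain n' where n: "n = Suc (Suc n')"
    using assms(1,2) that[of "n - 2"] by simp
  have n'1: "(3::int) \<le> 3 ^ n'"
    using assms(1,2) n power_increasing[of 1 n' "3::int"] by simp
  have z_bound: "0 \<le> z" "z \<le> 3 * 3 ^ n'"
  proof -
    have "(3::int) ^ j \<le> 3 ^ Suc n'" if "j < n" for j
      using that n by (intro power_increasing) auto
    then show "0 \<le> z" "z \<le> 3 * 3 ^ n'" using z by auto
  qed
  \<comment> \<open>The residue of \<open>z\<close> modulo 9 is 0, 1 or 3, so 9 divides neither
    \<open>2 + z\<close> nor \<open>3 + z\<close>.\<close>
  have zmod: "z = 0 \<or> z = 1 \<or> z = 3 \<or> 9 dvd z"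
  proof (cases "z = 0")
    case False
    then obtain j where j: "z = 3 ^ j" using z by auto
    show ?thesis
    proof (cases "j < 2")
      case True
      then have "j = 0 \<or> j = 1" by auto
      then show ?thesis using j by auto
    next
      case False
      then have "(3::int) ^ 2 dvd 3 ^ j" by (intro le_imp_power_dvd) simp
      then show ?thesis using j by simp
    qed
  qed simp
  show False
  proof (cases "Suc k < n")
    case True
    then have "(3::int) ^ k \<le> 3 ^ n'" using n by (intro power_increasing) auto
    then have "4 * 3 ^ k < (3 ^ n - 1 :: int)" using n'1 by (simp only: n power_Suc)
    then have "4 * 3 ^ k = 3 + z"
      using z_bound n'1 by (intro cong_less_imp_eq_int[OF _ _ _ _ cong]) (simp_all add: n)
    moreover have "(3::int) ^ 2 dvd 3 ^ k" using assms(1) by (intro le_imp_power_dvd)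
    then have "(9::int) dvd 4 * 3 ^ k" by (simp add: dvd_mult)
    ultimately have "9 dvd 3 + z" by simp
    with zmod show False by (auto simp: dvd_add_left_iff)
  next
    case False
    then have k: "k = Suc n'" using assms n by simp
    \<comment> \<open>In the boundary case the left side exceeds the modulus once, and this is its
      remainder.\<close>
    have "[1 + 3 * 3 ^ n' = 4 * 3 ^ k] (mod (3 ^ n - 1 :: int))"
      by (simp add: cong_iff_lin k n algebra_simps) (rule exI[of _ 1], simp)
    from cong_trans[OF this cong] have "1 + 3 * 3 ^ n' = 3 + z"
      using z_bound n'1 by (intro cong_less_imp_eq_int[of _ "3 ^ n - 1"]) (simp_all add: n)
    moreover have "(3::int) dvd 3 ^ n'" using n'1 by (cases n') auto
    then have "(9::int) dvd 3 * 3 ^ n'" by (auto simp: dvd_def)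
    ultimately have "9 dvd 2 + z" by (simp add: algebra_simps)
    with zmod show False by (auto simp: dvd_add_left_iff)
  qed
qed

text \<open>An equation between two words in \<open>x\<close> and \<open>y\<close>, the form that
  \<open>normal_aut_hom_eq\<close> can transport.\<close>

definition cubing_rel :: "('a, 'm) monoid_scheme \<Rightarrow> 'a \<Rightarrow> 'a \<Rightarrow> bool" where
  "cubing_rel G x y \<longleftrightarrow>
    (let c = x \<otimes>\<^bsub>G\<^esub> y \<otimes>\<^bsub>G\<^esub> inv\<^bsub>G\<^esub> x \<otimes>\<^bsub>G\<^esub> inv\<^bsub>G\<^esub> y
     in x \<otimes>\<^bsub>G\<^esub> c \<otimes>\<^bsub>G\<^esub> inv\<^bsub>G\<^esub> x = c \<otimes>\<^bsub>G\<^esub> c \<otimes>\<^bsub>G\<^esub> c)"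

section \<open>A permutation representation testing the relation\<close>

locale twisted_action = A: group A + B: group B
  for A :: "('a, 'm) monoid_scheme" and B :: "('b, 'n) monoid_scheme" +
  fixes m :: int and z :: "'a \<Rightarrow> int"
  assumes m: "m > 0"
begin

text \<open>\<open>actB\<close> is the action on the third coordinate of \<open>\<int>/m \<times> A \<times> B\<close> conjugated by the permutation
  \<open>(r, x, y) \<mapsto> (r + z x * \<delta> y, x, y)\<close>.\<close>

definition "pts = {0..<m} \<times> carrier A \<times> carrier B"
definition "\<delta> y = (if y = \<one>\<^bsub>B\<^esub> then 1 else 0 :: int)"
definition "actA a = (\<lambda>(r::int, x, y). (r, a \<otimes>\<^bsub>A\<^esub> x, y))"
definition "actB b = (\<lambda>(r, x, y). ((r + z x * (\<delta> y - \<delta> (b \<otimes>\<^bsub>B\<^esub> y))) mod m, x, b \<otimes>\<^bsub>B\<^esub> y))"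
definition "f a = restrict (actA a) pts"
definition "g b = restrict (actB b) pts"
definition "shift a b x y = (z x - z (inv\<^bsub>A\<^esub> a \<otimes>\<^bsub>A\<^esub> x)) * (\<delta> y - \<delta> (inv\<^bsub>B\<^esub> b \<otimes>\<^bsub>B\<^esub> y))"

lemma hom_f: "group_hom A (BijGroup pts) f"
proof -
  have "f \<in> hom A (BijGroup pts)"
    unfolding f_def by (rule hom_BijGroupI) (auto simp: pts_def actA_def A.m_assoc)
  then show ?thesis
    using A.is_group group_BijGroup by (simp add: group_hom_def group_hom_axioms_def)
qed

lemma hom_g: "group_hom B (BijGroup pts) g"
proof -
  have "g \<in> hom B (BijGroup pts)"
    unfolding g_def
  proof (rule hom_BijGroupI)
    fix b b' t assume b: "b \<in> carrier B" "b' \<in> carrier B" and "t \<in> pts"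
    then obtain r x y where t: "t = (r, x, y)" "y \<in> carrier B" by (auto simp: pts_def)
    have "(r + z x * (\<delta> y - \<delta> (b \<otimes>\<^bsub>B\<^esub> (b' \<otimes>\<^bsub>B\<^esub> y)))) mod m =
      ((r + z x * (\<delta> y - \<delta> (b' \<otimes>\<^bsub>B\<^esub> y))) mod m + z x * (\<delta> (b' \<otimes>\<^bsub>B\<^esub> y) - \<delta> (b \<otimes>\<^bsub>B\<^esub> (b' \<otimes>\<^bsub>B\<^esub> y)))) mod m"
      unfolding mod_add_left_eq by (simp add: algebra_simps)
    with b t show "actB (b \<otimes>\<^bsub>B\<^esub> b') t = actB b (actB b' t)"
      by (simp add: actB_def B.m_assoc)
  qed (use m in \<open>auto simp: pts_def actB_def\<close>)
  then show ?thesis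
    using B.is_group group_BijGroup by (simp add: group_hom_def group_hom_axioms_def)
qed

sublocale f: group_hom A "BijGroup pts" f by (rule hom_f)
sublocale g: group_hom B "BijGroup pts" g by (rule hom_g)

lemma f_apply: "r \<in> {0..<m} \<Longrightarrow> x \<in> carrier A \<Longrightarrow> y \<in> carrier B \<Longrightarrow> f a (r, x, y) = (r, a \<otimes>\<^bsub>A\<^esub> x, y)"
  by (simp add: f_def actA_def pts_def)

lemma g_apply: "r \<in> {0..<m} \<Longrightarrow> x \<in> carrier A \<Longrightarrow> y \<in> carrier B \<Longrightarrow>
    g b (r, x, y) = ((r + z x * (\<delta> y - \<delta> (b \<otimes>\<^bsub>B\<^esub> y))) mod m, x, b \<otimes>\<^bsub>B\<^esub> y)"
  by (simp add: g_def actB_def pts_def)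

text \<open>The translations of \<open>x\<close> and \<open>y\<close> commute, so the commutator
  changes the first coordinate only, by the mixed second difference of the function
  \<open>z x * \<delta> y\<close>.\<close>

lemma commutator_apply:
  assumes a: "a \<in> carrier A" and b: "b \<in> carrier B"
    and r: "r \<in> {0..<m}" and x: "x \<in> carrier A" and y: "y \<in> carrier B"
  shows "(f a \<otimes>\<^bsub>BijGroup pts\<^esub> g b \<otimes>\<^bsub>BijGroup pts\<^esub> inv\<^bsub>BijGroup pts\<^esub> f a \<otimes>\<^bsub>BijGroup pts\<^esub> inv\<^bsub>BijGroup pts\<^esub> g b)
    (r, x, y) = ((r + shift a b x y) mod m, x, y)"
proof -
  have t: "(s mod m, u, v) \<in> pts" "(r, u, v) \<in> pts"
    if "u \<in> carrier A" "v \<in> carrier B" for u v s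
    using m r that by (simp_all add: pts_def)
  have "((r + z x * (\<delta> y - \<delta> (inv\<^bsub>B\<^esub> b \<otimes>\<^bsub>B\<^esub> y))) mod m +
      z (inv\<^bsub>A\<^esub> a \<otimes>\<^bsub>A\<^esub> x) * (\<delta> (inv\<^bsub>B\<^esub> b \<otimes>\<^bsub>B\<^esub> y) - \<delta> y)) mod m = (r + shift a b x y) mod m"
    unfolding mod_add_left_eq by (simp add: shift_def algebra_simps)
  then show ?thesis
    using assms m t
    by (simp add: mult_BijGroup_apply f_apply g_apply A.inv_mult_cancel B.inv_mult_cancel
        flip: f.hom_inv g.hom_inv)
qed

text \<open>The commutator adds \<open>shift\<close> to the first coordinate. Conjugation by
  \<open>f a\<close> replaces the argument \<open>x\<close> by its translate, and cubing triples the
  amount added.\<close>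

lemma cubing_rel_iff:
  assumes a: "a \<in> carrier A" and b: "b \<in> carrier B"
  shows "cubing_rel (BijGroup pts) (f a) (g b) \<longleftrightarrow>
    (\<forall>x\<in>carrier A. \<forall>y\<in>carrier B. [shift a b (inv\<^bsub>A\<^esub> a \<otimes>\<^bsub>A\<^esub> x) y = 3 * shift a b x y] (mod m))"
proof -
  let ?H = "BijGroup pts"
  define c where "c = f a \<otimes>\<^bsub>?H\<^esub> g b \<otimes>\<^bsub>?H\<^esub> inv\<^bsub>?H\<^esub> f a \<otimes>\<^bsub>?H\<^esub> inv\<^bsub>?H\<^esub> g b"
  have c: "c \<in> carrier ?H" using a b by (simp add: c_def)
  have c_apply: "c (r, x, y) = ((r + shift a b x y) mod m, x, y)"
    if "r \<in> {0..<m}" "x \<in> carrier A" "y \<in> carrier B" for r x y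
    unfolding c_def using that by (rule commutator_apply[OF a b])
  have lhs: "(f a \<otimes>\<^bsub>?H\<^esub> c \<otimes>\<^bsub>?H\<^esub> inv\<^bsub>?H\<^esub> f a) (r, x, y) =
      ((r + shift a b (inv\<^bsub>A\<^esub> a \<otimes>\<^bsub>A\<^esub> x) y) mod m, x, y)"
    and rhs: "(c \<otimes>\<^bsub>?H\<^esub> c \<otimes>\<^bsub>?H\<^esub> c) (r, x, y) = ((r + 3 * shift a b x y) mod m, x, y)"
    if t: "r \<in> {0..<m}" "x \<in> carrier A" "y \<in> carrier B" for r x y
  proof -
    have mem: "(s mod m, u, y) \<in> pts" "(r, u, y) \<in> pts" if "u \<in> carrier A" for s u
      using m t that by (simp_all add: pts_def)
    show "(f a \<otimes>\<^bsub>?H\<^esub> c \<otimes>\<^bsub>?H\<^esub> inv\<^bsub>?H\<^esub> f a) (r, x, y) =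
        ((r + shift a b (inv\<^bsub>A\<^esub> a \<otimes>\<^bsub>A\<^esub> x) y) mod m, x, y)"
      using a t m mem c
      by (simp add: mult_BijGroup_apply f_apply c_apply A.inv_mult_cancel flip: f.hom_inv)
    have "(((r + shift a b x y) mod m + shift a b x y) mod m + shift a b x y) mod m =
        (r + 3 * shift a b x y) mod m"
      unfolding mod_add_left_eq by (simp add: algebra_simps)
    then show "(c \<otimes>\<^bsub>?H\<^esub> c \<otimes>\<^bsub>?H\<^esub> c) (r, x, y) = ((r + 3 * shift a b x y) mod m, x, y)"
      using t m mem c by (simp add: mult_BijGroup_apply c_apply)
  qed
  show ?thesis
  proof
    assume "cubing_rel ?H (f a) (g b)"
    then have eq: "f a \<otimes>\<^bsub>?H\<^esub> c \<otimes>\<^bsub>?H\<^esub> inv\<^bsub>?H\<^esub> f a = c \<otimes>\<^bsub>?H\<^esub> c \<otimes>\<^bsub>?H\<^esub> c"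
      by (simp add: cubing_rel_def c_def Let_def)
    show "\<forall>x\<in>carrier A. \<forall>y\<in>carrier B. [shift a b (inv\<^bsub>A\<^esub> a \<otimes>\<^bsub>A\<^esub> x) y = 3 * shift a b x y] (mod m)"
      using lhs[of 0] rhs[of 0] m by (auto simp: eq cong_def)
  next
    assume cong: "\<forall>x\<in>carrier A. \<forall>y\<in>carrier B. [shift a b (inv\<^bsub>A\<^esub> a \<otimes>\<^bsub>A\<^esub> x) y = 3 * shift a b x y] (mod m)"
    have "f a \<otimes>\<^bsub>?H\<^esub> c \<otimes>\<^bsub>?H\<^esub> inv\<^bsub>?H\<^esub> f a = c \<otimes>\<^bsub>?H\<^esub> c \<otimes>\<^bsub>?H\<^esub> c"
    proof (rule carrier_BijGroup_eqI[of _ pts])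
      fix t assume "t \<in> pts"
      then obtain r x y where t: "t = (r, x, y)" "r \<in> {0..<m}" "x \<in> carrier A" "y \<in> carrier B"
        by (auto simp: pts_def)
      have "[r + shift a b (inv\<^bsub>A\<^esub> a \<otimes>\<^bsub>A\<^esub> x) y = r + 3 * shift a b x y] (mod m)"
        using cong t by (intro cong_add) simp_all
      then show "(f a \<otimes>\<^bsub>?H\<^esub> c \<otimes>\<^bsub>?H\<^esub> inv\<^bsub>?H\<^esub> f a) t = (c \<otimes>\<^bsub>?H\<^esub> c \<otimes>\<^bsub>?H\<^esub> c) t"
        using t by (simp add: lhs rhs cong_def)
    qed (use a c in simp_all)
    then show "cubing_rel ?H (f a) (g b)" by (simp add: cubing_rel_def c_def Let_def)
  qed
qed

end

text \<open>For \<open>z\<close> one takes the function with \<open>z (a\<^sup>-\<^sup>i) = 3\<^sup>i\<close> modulo \<open>3\<^sup>n - 1\<close>, where \<open>n\<close> is the order of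
  \<open>a\<close>, vanishing outside the powers of \<open>a\<close>: on the submodule it spans, \<open>a\<close> acts as multiplication by \<open>3\<close>.\<close>

lemma exists_action_detecting:
  fixes A :: "('a, 'm) monoid_scheme" and B :: "('b, 'n) monoid_scheme"
  assumes A: "group A" "finite (carrier A)" and B: "group B" "finite (carrier B)"
    and a: "a \<in> carrier A" "a \<noteq> \<one>\<^bsub>A\<^esub>" and a': "a' \<in> carrier A" "a' \<noteq> \<one>\<^bsub>A\<^esub>" "a' \<noteq> a"
    and b': "b' \<in> carrier B" "b' \<noteq> \<one>\<^bsub>B\<^esub>"
  obtains E :: "(int \<times> 'a \<times> 'b) set" and f g
  where "finite E" "f \<in> hom A (BijGroup E)" "g \<in> hom B (BijGroup E)"
    "\<forall>b\<in>carrier B. cubing_rel (BijGroup E) (f a) (g b)"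
    "\<not> cubing_rel (BijGroup E) (f a') (g b')"
proof -
  interpret A: group A by fact
  interpret B: group B by fact
  \<comment> \<open>\<open>shift\<close> translates by the inverse of \<open>a\<close>, so
    \<open>z\<close> is built on the powers of that inverse.\<close>
  define d where "d = inv\<^bsub>A\<^esub> a"
  have d: "d \<in> carrier A" using a by (simp add: d_def)
  define n where "n = A.ord d"
  have n_eq: "d [^]\<^bsub>A\<^esub> n = \<one>\<^bsub>A\<^esub>" using d by (simp add: n_def)
  have "n \<noteq> 0" using A.ord_ge_1[OF A(2) d] by (simp add: n_def)
  moreover have "n \<noteq> 1" using A.ord_eq_1[OF d] a by (simp add: n_def d_def)
  ultimately obtain n' where n': "n = Suc (Suc n')" by (metis One_nat_def not0_implies_Suc)
  define m :: int where "m = 3 ^ n - 1"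
  have n'1: "(1::int) \<le> 3 ^ n'" by simp
  have m_eq: "m = 9 * 3 ^ n' - 1" by (simp add: m_def n')
  then have m: "m > 0" using n'1 by linarith
  define z :: "'a \<Rightarrow> int" where
    "z x = (if \<exists>i<n. x = d [^]\<^bsub>A\<^esub> i then 3 ^ (THE i. i < n \<and> x = d [^]\<^bsub>A\<^esub> i) else 0)" for x
  have pow_inj: "i = j" if "d [^]\<^bsub>A\<^esub> i = d [^]\<^bsub>A\<^esub> j" "i < n" "j < n" for i j
    using A.ord_inj[OF d] that by (auto simp: n_def inj_on_def)
  have z_pow: "z (d [^]\<^bsub>A\<^esub> i) = 3 ^ i" if "i < n" for i
  proof -
    have "(THE j. j < n \<and> d [^]\<^bsub>A\<^esub> i = d [^]\<^bsub>A\<^esub> j) = i"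
      using that pow_inj by (intro the_equality) auto
    then show ?thesis using that by (auto simp: z_def)
  qed
  have z_cases: "(\<exists>i<n. x = d [^]\<^bsub>A\<^esub> i) \<or> z x = 0" for x
    by (simp add: z_def)
  have z_step: "[z (d \<otimes>\<^bsub>A\<^esub> x) = 3 * z x] (mod m)" if x: "x \<in> carrier A" for x
  proof (cases "\<exists>i<n. x = d [^]\<^bsub>A\<^esub> i")
    case True
    then obtain i where i: "i < n" "x = d [^]\<^bsub>A\<^esub> i" by blast
    then have dx: "d \<otimes>\<^bsub>A\<^esub> x = d [^]\<^bsub>A\<^esub> Suc i" using A.nat_pow_Suc2[OF d] by simp
    show ?thesis
    proof (cases "Suc i < n")
      case True
      then have "z (d \<otimes>\<^bsub>A\<^esub> x) = 3 * z x" unfolding dx using z_pow[OF True] z_pow[OF i(1)] i by simp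
      then show ?thesis by simp
    next
      case False
      \<comment> \<open>Wrapping around from \<open>3 ^ (n - 1)\<close> to \<open>3 ^ 0\<close> is
        consistent because the modulus is \<open>3 ^ n - 1\<close>.\<close>
      then have "Suc i = n" using i by simp
      then have "z (d \<otimes>\<^bsub>A\<^esub> x) = 1" "3 * z x = 3 ^ n"
        using dx n_eq z_pow[of 0] z_pow[OF i(1)] i by (auto simp del: A.nat_pow_Suc)
      moreover have "[3 ^ n = 1] (mod m)" by (simp add: m_def cong_iff_dvd_diff)
      ultimately show ?thesis by (simp add: cong_sym)
    qed
  next
    case False
    \<comment> \<open>The set of powers of \<open>d\<close> is also closed under division by
      \<open>d\<close>, so off this set both values are 0.\<close>
    have "\<not> (\<exists>i<n. d \<otimes>\<^bsub>A\<^esub> x = d [^]\<^bsub>A\<^esub> i)"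
    proof
      assume "\<exists>i<n. d \<otimes>\<^bsub>A\<^esub> x = d [^]\<^bsub>A\<^esub> i"
      then obtain i where i: "i < n" "d \<otimes>\<^bsub>A\<^esub> x = d [^]\<^bsub>A\<^esub> i" by blast
      obtain j where j: "j < n" "d [^]\<^bsub>A\<^esub> i = d [^]\<^bsub>A\<^esub> Suc j"
      proof (cases i)
        case 0
        then show thesis using that[of "n - 1"] n_eq n' by (simp del: A.nat_pow_Suc)
      next
        case (Suc j)
        then show thesis using that[of j] i by simp
      qed
      then have "d \<otimes>\<^bsub>A\<^esub> x = d \<otimes>\<^bsub>A\<^esub> d [^]\<^bsub>A\<^esub> j"
        using i A.nat_pow_Suc2[OF d] by simp
      then have "x = d [^]\<^bsub>A\<^esub> j" using d x by simp
      with False j show False by blast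
    qed
    with False z_cases show ?thesis by (metis cong_refl mult_zero_right)
  qed
  interpret T: twisted_action A B m z by unfold_locales (rule m)
  \<comment> \<open>The factor of \<open>shift\<close> coming from \<open>y\<close> is the same on
    both sides; the one coming from \<open>x\<close> is tripled by \<open>z_step\<close>.\<close>
  have rel: "cubing_rel (BijGroup T.pts) (T.f a) (T.g b)" if b: "b \<in> carrier B" for b
    unfolding T.cubing_rel_iff[OF a(1) b]
  proof (intro ballI)
    fix x y assume x: "x \<in> carrier A" and "y \<in> carrier B"
    have "[z (d \<otimes>\<^bsub>A\<^esub> x) - z (d \<otimes>\<^bsub>A\<^esub> (d \<otimes>\<^bsub>A\<^esub> x)) = 3 * z x - 3 * z (d \<otimes>\<^bsub>A\<^esub> x)] (mod m)"
      using z_step x d by (intro cong_diff) simp_all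
    from cong_mult[OF this cong_refl]
    have "[(z (d \<otimes>\<^bsub>A\<^esub> x) - z (d \<otimes>\<^bsub>A\<^esub> (d \<otimes>\<^bsub>A\<^esub> x))) * e = 3 * ((z x - z (d \<otimes>\<^bsub>A\<^esub> x)) * e)] (mod m)" for e
      by (simp only: right_diff_distrib[symmetric] mult.assoc)
    then show "[T.shift a b (inv\<^bsub>A\<^esub> a \<otimes>\<^bsub>A\<^esub> x) y = 3 * T.shift a b x y] (mod m)"
      by (simp only: T.shift_def d_def[symmetric])
  qed
  have not_rel: "\<not> cubing_rel (BijGroup T.pts) (T.f a') (T.g b')"
    unfolding T.cubing_rel_iff[OF a'(1) b'(1)]
  proof
    assume cong: "\<forall>x\<in>carrier A. \<forall>y\<in>carrier B. [T.shift a' b' (inv\<^bsub>A\<^esub> a' \<otimes>\<^bsub>A\<^esub> x) y = 3 * T.shift a' b' x y] (mod m)"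
    define e where "e = inv\<^bsub>A\<^esub> a'"
    have e: "e \<in> carrier A" using a' by (simp add: e_def)
    \<comment> \<open>Evaluate at the two units: \<open>z\<close> is 1 there, and the difference of
      the \<open>\<delta>\<close> values is 1 because \<open>b'\<close> is not trivial.\<close>
    have "[z e - z (e \<otimes>\<^bsub>A\<^esub> e) = 3 * (1 - z e)] (mod m)"
      using cong[rule_format, of "\<one>\<^bsub>A\<^esub>" "\<one>\<^bsub>B\<^esub>"] b' e z_pow[of 0] n'
      by (simp add: T.shift_def T.\<delta>_def e_def[symmetric])
    then have "[z e - z (e \<otimes>\<^bsub>A\<^esub> e) + (3 * z e + z (e \<otimes>\<^bsub>A\<^esub> e)) = 3 * (1 - z e) + (3 * z e + z (e \<otimes>\<^bsub>A\<^esub> e))] (mod m)"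
      by (rule cong_add) simp
    then have cong': "[4 * z e = 3 + z (e \<otimes>\<^bsub>A\<^esub> e)] (mod m)"
      by (simp add: algebra_simps)
    have z2: "z (e \<otimes>\<^bsub>A\<^esub> e) = 0 \<or> (\<exists>j<n. z (e \<otimes>\<^bsub>A\<^esub> e) = 3 ^ j)"
      using z_cases[of "e \<otimes>\<^bsub>A\<^esub> e"] z_pow by auto
    show False
    proof (cases "\<exists>k<n. e = d [^]\<^bsub>A\<^esub> k")
      case True
      then obtain k where k: "k < n" "e = d [^]\<^bsub>A\<^esub> k" by blast
      have "k \<noteq> 0"
      proof
        assume "k = 0"
        with k(2) have "inv\<^bsub>A\<^esub> a' = \<one>\<^bsub>A\<^esub>" by (simp add: e_def)
        with a'(1,2) show False by simp
      qed
      moreover have "k \<noteq> 1"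
      proof
        assume "k = 1"
        with k(2) d have "inv\<^bsub>A\<^esub> a' = inv\<^bsub>A\<^esub> a" by (simp add: e_def d_def)
        with a(1) a'(1,3) show False using inj_onD[OF A.inv_inj, of a' a] by simp
      qed
      ultimately show False
        using not_cong_pow3[of k n "z (e \<otimes>\<^bsub>A\<^esub> e)"] k z2 cong' z_pow[OF k(1)] by (simp add: m_def)
    next
      case False
      then have "z e = 0" using z_cases by blast
      with cong' have "[0 = 3 + z (e \<otimes>\<^bsub>A\<^esub> e)] (mod m)" by simp
      then have "m dvd 3 + z (e \<otimes>\<^bsub>A\<^esub> e)" using cong_sym cong_0_iff by blast
      moreover have "3 ^ j \<le> (3::int) ^ Suc n'" if "j < n" for j
        using that n' by (intro power_increasing) auto
      then have "0 \<le> z (e \<otimes>\<^bsub>A\<^esub> e)" "z (e \<otimes>\<^bsub>A\<^esub> e) \<le> 3 * 3 ^ n'" using z2 by auto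
      ultimately show False
        using n'1 m_eq zdvd_imp_le[of m "3 + z (e \<otimes>\<^bsub>A\<^esub> e)"] by linarith
    qed
  qed
  have "finite T.pts" using A(2) B(2) by (simp add: T.pts_def)
  with rel not_rel show thesis
    using that[of T.pts T.f T.g] T.f.homh T.g.homh by blast
qed

section \<open>Automorphisms preserving the factors\<close>

context residually_finite_factors
begin

lemma normal_aut_cubing_rel:
  assumes \<psi>: "normal_aut P \<psi>" and h: "group_hom P H h" and H: "residually_finite H"
    and x: "x \<in> carrier P" and y: "y \<in> carrier P" and rel: "cubing_rel H (h x) (h y)"
  shows "cubing_rel H (h (\<psi> x)) (h (\<psi> y))"
proof -
  interpret h: group_hom P H h by fact
  interpret \<psi>: group_hom P P \<psi> using \<psi> by (rule normal_aut_hom)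
  let ?c = "x \<cdot> y \<cdot> inv\<^bsub>P\<^esub> x \<cdot> inv\<^bsub>P\<^esub> y"
  have "h (x \<cdot> ?c \<cdot> inv\<^bsub>P\<^esub> x) = h (?c \<cdot> ?c \<cdot> ?c)"
    using rel x y by (simp add: cubing_rel_def Let_def)
  from normal_aut_hom_eq[OF \<psi> h H _ _ this] show ?thesis
    using x y by (simp add: cubing_rel_def Let_def)
qed

lemma residually_finite_BijGroup: "finite E \<Longrightarrow> residually_finite (BijGroup E)"
  by (intro finite_imp_residually_finite group_BijGroup finite_carrier_BijGroup)

text \<open>If \<open>a\<close> and \<open>a'\<close> differed, they would do so in a finite
  quotient. There a relation holding at the images of \<open>a\<close> and \<open>b\<close> would
  fail at those of \<open>a'\<close> and \<open>b'\<close>, against its transport by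
  \<open>\<psi>\<close>.\<close>

lemma normal_aut_fixes_A:
  assumes \<psi>: "normal_aut P \<psi>"
    and a: "a \<in> carrier A" "a' \<in> carrier A" "\<psi> (\<iota>A a) = \<iota>A a'" "a \<noteq> \<one>\<^bsub>A\<^esub>" "a' \<noteq> \<one>\<^bsub>A\<^esub>"
    and b: "b \<in> carrier B" "b' \<in> carrier B" "\<psi> (\<iota>B b) = \<iota>B b'" "b' \<noteq> \<one>\<^bsub>B\<^esub>"
  shows "a' = a"
proof (rule ccontr)
  assume "a' \<noteq> a"
  then have "a' \<otimes>\<^bsub>A\<^esub> inv\<^bsub>A\<^esub> a \<noteq> \<one>\<^bsub>A\<^esub>"
    using a A.inv_solve_right'[of "\<one>\<^bsub>A\<^esub>" a' a] by simp
  \<comment> \<open>The third element keeps the images of \<open>a'\<close> and \<open>a\<close>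
    distinct.\<close>
  then have S: "{a, a', a' \<otimes>\<^bsub>A\<^esub> inv\<^bsub>A\<^esub> a} \<subseteq> carrier A - {\<one>\<^bsub>A\<^esub>}" using a by simp
  obtain QA :: "'a set monoid" and qA where qA: "group QA" "finite (carrier QA)" "qA \<in> hom A QA"
    "\<forall>x\<in>{a, a', a' \<otimes>\<^bsub>A\<^esub> inv\<^bsub>A\<^esub> a}. qA x \<noteq> \<one>\<^bsub>QA\<^esub>"
    by (rule residually_finite_hom[OF A.is_group rf_A _ S]) simp
  obtain QB :: "'b set monoid" and qB where qB: "group QB" "finite (carrier QB)" "qB \<in> hom B QB"
    "\<forall>x\<in>{b'}. qB x \<noteq> \<one>\<^bsub>QB\<^esub>"
    by (rule residually_finite_hom[OF B.is_group rf_B, of "{b'}"]) (use b in simp_all)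
  interpret qA: group_hom A QA qA using qA A.is_group by (simp add: group_hom_def group_hom_axioms_def)
  interpret qB: group_hom B QB qB using qB B.is_group by (simp add: group_hom_def group_hom_axioms_def)
  have ne: "qA a' \<noteq> qA a"
  proof
    assume "qA a' = qA a"
    then have "qA (a' \<otimes>\<^bsub>A\<^esub> inv\<^bsub>A\<^esub> a) = \<one>\<^bsub>QA\<^esub>" using a(1,2) by simp
    with qA(4) show False by blast
  qed
  obtain E :: "(int \<times> 'a set \<times> 'b set) set" and f g
    where E: "finite E" "f \<in> hom QA (BijGroup E)" "g \<in> hom QB (BijGroup E)"
      "\<forall>y\<in>carrier QB. cubing_rel (BijGroup E) (f (qA a)) (g y)"
      "\<not> cubing_rel (BijGroup E) (f (qA a')) (g (qB b'))"
    by (rule exists_action_detecting[OF qA(1,2) qB(1,2), of "qA a" "qA a'" "qB b'"])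
       (use ne a b qA(4) qB(4) in simp_all)
  have "(\<lambda>x. f (qA x)) \<in> hom A (BijGroup E)" "(\<lambda>y. g (qB y)) \<in> hom B (BijGroup E)"
    using hom_compose[OF qA.homh E(2)] hom_compose[OF qB.homh E(3)] by (simp_all add: comp_def)
  then obtain h where h: "group_hom P (BijGroup E) h"
    "\<And>x. x \<in> carrier A \<Longrightarrow> h (\<iota>A x) = f (qA x)" "\<And>y. y \<in> carrier B \<Longrightarrow> h (\<iota>B y) = g (qB y)"
    using hom_extend[OF group_BijGroup] by blast
  have "cubing_rel (BijGroup E) (h (\<iota>A a)) (h (\<iota>B b))"
    using E(4) a b by (simp add: h)
  from normal_aut_cubing_rel[OF \<psi> h(1) residually_finite_BijGroup[OF E(1)] _ _ this]
  have "cubing_rel (BijGroup E) (f (qA a')) (g (qB b'))"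
    using a b by (simp add: h)
  with E(5) show False by simp
qed

text \<open>The relation is not symmetric in its two arguments, so the argument is repeated with the
  factors exchanged.\<close>

lemma normal_aut_fixes_B:
  assumes \<psi>: "normal_aut P \<psi>"
    and b: "b \<in> carrier B" "b' \<in> carrier B" "\<psi> (\<iota>B b) = \<iota>B b'" "b \<noteq> \<one>\<^bsub>B\<^esub>" "b' \<noteq> \<one>\<^bsub>B\<^esub>"
    and a: "a \<in> carrier A" "a' \<in> carrier A" "\<psi> (\<iota>A a) = \<iota>A a'" "a' \<noteq> \<one>\<^bsub>A\<^esub>"
  shows "b' = b"
proof (rule ccontr)
  assume "b' \<noteq> b"
  then have "b' \<otimes>\<^bsub>B\<^esub> inv\<^bsub>B\<^esub> b \<noteq> \<one>\<^bsub>B\<^esub>"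
    using b B.inv_solve_right'[of "\<one>\<^bsub>B\<^esub>" b' b] by simp
  then have S: "{b, b', b' \<otimes>\<^bsub>B\<^esub> inv\<^bsub>B\<^esub> b} \<subseteq> carrier B - {\<one>\<^bsub>B\<^esub>}" using b by simp
  obtain QB :: "'b set monoid" and qB where qB: "group QB" "finite (carrier QB)" "qB \<in> hom B QB"
    "\<forall>x\<in>{b, b', b' \<otimes>\<^bsub>B\<^esub> inv\<^bsub>B\<^esub> b}. qB x \<noteq> \<one>\<^bsub>QB\<^esub>"
    by (rule residually_finite_hom[OF B.is_group rf_B _ S]) simp
  obtain QA :: "'a set monoid" and qA where qA: "group QA" "finite (carrier QA)" "qA \<in> hom A QA"
    "\<forall>x\<in>{a'}. qA x \<noteq> \<one>\<^bsub>QA\<^esub>"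
    by (rule residually_finite_hom[OF A.is_group rf_A, of "{a'}"]) (use a in simp_all)
  interpret qA: group_hom A QA qA using qA A.is_group by (simp add: group_hom_def group_hom_axioms_def)
  interpret qB: group_hom B QB qB using qB B.is_group by (simp add: group_hom_def group_hom_axioms_def)
  have ne: "qB b' \<noteq> qB b"
  proof
    assume "qB b' = qB b"
    then have "qB (b' \<otimes>\<^bsub>B\<^esub> inv\<^bsub>B\<^esub> b) = \<one>\<^bsub>QB\<^esub>" using b(1,2) by simp
    with qB(4) show False by blast
  qed
  obtain E :: "(int \<times> 'b set \<times> 'a set) set" and f g
    where E: "finite E" "f \<in> hom QB (BijGroup E)" "g \<in> hom QA (BijGroup E)"
      "\<forall>y\<in>carrier QA. cubing_rel (BijGroup E) (f (qB b)) (g y)"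
      "\<not> cubing_rel (BijGroup E) (f (qB b')) (g (qA a'))"
    by (rule exists_action_detecting[OF qB(1,2) qA(1,2), of "qB b" "qB b'" "qA a'"])
       (use ne a b qA(4) qB(4) in simp_all)
  have "(\<lambda>y. f (qB y)) \<in> hom B (BijGroup E)" "(\<lambda>x. g (qA x)) \<in> hom A (BijGroup E)"
    using hom_compose[OF qB.homh E(2)] hom_compose[OF qA.homh E(3)] by (simp_all add: comp_def)
  then obtain h where h: "group_hom P (BijGroup E) h"
    "\<And>x. x \<in> carrier A \<Longrightarrow> h (\<iota>A x) = g (qA x)" "\<And>y. y \<in> carrier B \<Longrightarrow> h (\<iota>B y) = f (qB y)"
    using hom_extend[OF group_BijGroup] by blast
  have "cubing_rel (BijGroup E) (h (\<iota>B b)) (h (\<iota>A a))"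
    using E(4) a b by (simp add: h)
  from normal_aut_cubing_rel[OF \<psi> h(1) residually_finite_BijGroup[OF E(1)] _ _ this]
  have "cubing_rel (BijGroup E) (f (qB b')) (g (qA a'))"
    using a b by (simp add: h)
  with E(5) show False by simp
qed

lemma normal_aut_preserving_factors:
  assumes \<psi>: "normal_aut P \<psi>" and img: "\<And>s w. w \<in> factor s \<Longrightarrow> \<psi> w \<in> factor s"
    and ntA: "carrier A \<noteq> {\<one>\<^bsub>A\<^esub>}" and ntB: "carrier B \<noteq> {\<one>\<^bsub>B\<^esub>}"
    and w: "w \<in> carrier P"
  shows "\<psi> w = w"
proof -
  interpret \<psi>: group_hom P P \<psi> using \<psi> by (rule normal_aut_hom)
  have inj: "inj_on \<psi> (carrier P)"
    using \<psi> by (simp add: normal_aut_def iso_def bij_betw_def)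
  have ne: "\<psi> u \<noteq> []" if "u \<in> carrier P" "u \<noteq> []" for u
    using inj_onD[OF inj, of u "[]"] that \<psi>.hom_one by (auto simp: one_P)
  have A_img: "\<exists>a'\<in>carrier A. \<psi> (\<iota>A a) = \<iota>A a' \<and> (a \<noteq> \<one>\<^bsub>A\<^esub> \<longrightarrow> a' \<noteq> \<one>\<^bsub>A\<^esub>)" if "a \<in> carrier A" for a
    using img[of "\<iota>A a" True] ne[of "\<iota>A a"] that by (auto simp: factor_eq \<iota>A_eq split: if_splits)
  have B_img: "\<exists>b'\<in>carrier B. \<psi> (\<iota>B b) = \<iota>B b' \<and> (b \<noteq> \<one>\<^bsub>B\<^esub> \<longrightarrow> b' \<noteq> \<one>\<^bsub>B\<^esub>)" if "b \<in> carrier B" for b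
    using img[of "\<iota>B b" False] ne[of "\<iota>B b"] that by (auto simp: factor_eq \<iota>B_eq split: if_splits)
  \<comment> \<open>Nontriviality of each factor supplies the partner against which the letters of
    the other one are tested.\<close>
  obtain a0 where a0: "a0 \<in> carrier A" "a0 \<noteq> \<one>\<^bsub>A\<^esub>" using ntA A.one_closed by blast
  obtain b0 where b0: "b0 \<in> carrier B" "b0 \<noteq> \<one>\<^bsub>B\<^esub>" using ntB B.one_closed by blast
  have A_fix: "\<psi> (\<iota>A a) = \<iota>A a" if a: "a \<in> carrier A" "a \<noteq> \<one>\<^bsub>A\<^esub>" for a
  proof -
    obtain a' where a': "a' \<in> carrier A" "\<psi> (\<iota>A a) = \<iota>A a'" "a' \<noteq> \<one>\<^bsub>A\<^esub>" using A_img[OF a(1)] a by blast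
    obtain b' where b': "b' \<in> carrier B" "\<psi> (\<iota>B b0) = \<iota>B b'" "b' \<noteq> \<one>\<^bsub>B\<^esub>" using B_img[OF b0(1)] b0 by blast
    from normal_aut_fixes_A[OF \<psi> a(1) a'(1,2) a(2) a'(3) b0(1) b'] a'(2) show ?thesis by simp
  qed
  have B_fix: "\<psi> (\<iota>B b) = \<iota>B b" if b: "b \<in> carrier B" "b \<noteq> \<one>\<^bsub>B\<^esub>" for b
  proof -
    obtain b' where b': "b' \<in> carrier B" "\<psi> (\<iota>B b) = \<iota>B b'" "b' \<noteq> \<one>\<^bsub>B\<^esub>" using B_img[OF b(1)] b by blast
    obtain a' where a': "a' \<in> carrier A" "\<psi> (\<iota>A a0) = \<iota>A a'" "a' \<noteq> \<one>\<^bsub>A\<^esub>" using A_img[OF a0(1)] a0 by blast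
    from normal_aut_fixes_B[OF \<psi> b(1) b'(1,2) b(2) b'(3) a0(1) a'] b'(2) show ?thesis by simp
  qed
  have letter: "\<psi> [x] = [x]" if "[x] \<in> carrier P" for x
    using that A_fix B_fix by (cases x) (auto simp: \<iota>A_eq \<iota>B_eq)
  show ?thesis
    using w
  proof (induction w)
    case Nil
    then show ?case using \<psi>.hom_one by (simp add: one_P)
  next
    case (Cons x w)
    then have mem: "[x] \<in> carrier P" "w \<in> carrier P" using Cons_closed_iff[of x w] by auto
    have "\<psi> ([x] \<cdot> w) = [x] \<cdot> w"
      using \<psi>.hom_mult[OF mem] letter[OF mem(1)] Cons.IH[OF mem(2)] by simp
    then show ?case using Cons_eq_mult[OF Cons.prems] by simp
  qed
qed

text \<open>Once conjugation by \<open>g\<close> has made both factors invariant, the automorphism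
  has become the identity, so \<phi> is conjugation by the inverse of \<open>g\<close>.\<close>

theorem normal_aut_inner:
  assumes \<phi>: "normal_aut P \<phi>"
    and nt: "carrier A \<noteq> {\<one>\<^bsub>A\<^esub>}" "carrier B \<noteq> {\<one>\<^bsub>B\<^esub>}"
  obtains g where "g \<in> carrier P" "\<And>w. w \<in> carrier P \<Longrightarrow> \<phi> w = g \<cdot> w \<cdot> inv\<^bsub>P\<^esub> g"
proof -
  interpret \<phi>: group_hom P P \<phi> using \<phi> by (rule normal_aut_hom)
  obtain g where g: "g \<in> carrier P" "normal_aut P (\<lambda>x. g \<cdot> \<phi> x \<cdot> inv\<^bsub>P\<^esub> g)"
    "\<And>s w. w \<in> factor s \<Longrightarrow> g \<cdot> \<phi> w \<cdot> inv\<^bsub>P\<^esub> g \<in> factor s"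
    by (rule normal_aut_factors_up_to_conj[OF \<phi>], erule that, assumption, simp)
  show thesis
  proof (rule that)
    show "inv\<^bsub>P\<^esub> g \<in> carrier P" using g by simp
    fix w assume w: "w \<in> carrier P"
    have "g \<cdot> \<phi> w \<cdot> inv\<^bsub>P\<^esub> g = w"
      by (rule normal_aut_preserving_factors[OF g(2) g(3) nt w])
    moreover have "inv\<^bsub>P\<^esub> g \<cdot> (g \<cdot> \<phi> w \<cdot> inv\<^bsub>P\<^esub> g) \<cdot> inv\<^bsub>P\<^esub> (inv\<^bsub>P\<^esub> g) = \<phi> w"
      using g(1) \<phi>.hom_closed[OF w] by (simp add: P.m_assoc P.inv_mult_cancel)
    ultimately show "\<phi> w = inv\<^bsub>P\<^esub> g \<cdot> w \<cdot> inv\<^bsub>P\<^esub> (inv\<^bsub>P\<^esub> g)" by simp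
  qed
qed

end

section \<open>Transfer from the free product to \<open>G\<close>, and the conclusion\<close>

text \<open>\<open>G\<close> is only isomorphic to the free product. Normal subgroups of finite
  index pull back along \<open>i\<close> to such subgroups of \<open>G\<close>, which \<phi>
  preserves.\<close>

lemma normal_aut_transport:
  assumes "group G" "group P" and i: "i \<in> iso G P" and \<phi>: "normal_aut G \<phi>"
  shows "normal_aut P (\<lambda>w. i (\<phi> (inv_into (carrier G) i w)))"
proof -
  interpret G: group G by fact
  let ?j = "inv_into (carrier G) i"
  have bij: "bij_betw i (carrier G) (carrier P)" using i by (simp add: iso_def)
  have j: "?j \<in> iso P G" using G.iso_set_sym[OF i] .
  have jG: "?j w \<in> carrier G" if "w \<in> carrier P" for w
    using j that by (auto simp: iso_def hom_def)
  have \<phi>': "\<phi> \<in> iso G G" using \<phi> by (simp add: normal_aut_def)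
  have "(\<lambda>w. i (\<phi> (?j w))) \<in> iso P P"
    using iso_set_trans[OF iso_set_trans[OF j \<phi>'] i] by (simp add: comp_def)
  moreover have "(\<lambda>w. i (\<phi> (?j w))) ` N = N" if N: "finite_index_normal N P" for N
  proof -
    have NP: "N \<subseteq> carrier P"
      using N normal_imp_subgroup[THEN subgroup.subset] by (auto simp: finite_index_normal_def)
    have hom: "group_hom G P i"
      using i assms(1,2) by (simp add: group_hom_def group_hom_axioms_def iso_def)
    let ?M = "{x \<in> carrier G. i x \<in> N}"
    have "\<phi> ` ?M = ?M"
      using \<phi> finite_index_normal_vimage[OF hom N] by (simp add: normal_aut_def)
    moreover have "?j ` N = ?M"
    proof
      show "?j ` N \<subseteq> ?M"
        using NP jG bij_betw_inv_into_right[OF bij] by auto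
      show "?M \<subseteq> ?j ` N"
        using bij_betw_inv_into_left[OF bij] by (force simp: image_iff)
    qed
    moreover have "i ` ?M = N"
    proof
      show "N \<subseteq> i ` ?M"
      proof
        fix w assume w: "w \<in> N"
        then obtain x where "x \<in> carrier G" "w = i x"
          using NP bij_betw_imp_surj_on[OF bij] by (metis imageE subsetD)
        with w show "w \<in> i ` ?M" by simp
      qed
    qed auto
    moreover have "(\<lambda>w. i (\<phi> (?j w))) ` N = i ` \<phi> ` ?j ` N"
      by (simp only: image_image)
    ultimately show ?thesis by simp
  qed
  ultimately show ?thesis by (simp add: normal_aut_def)
qed

text \<open>Apply \<open>normal_aut_conj\<close> to the identity; the rest deals with the
  restriction to the carrier.\<close>

lemma Inn_subset_Aut_nf:
  assumes "group G"
  shows "Inn G \<subseteq> Aut_nf G"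
proof
  interpret G: group G by fact
  fix \<phi> assume "\<phi> \<in> Inn G"
  then obtain g where g: "g \<in> carrier G" and \<phi>: "\<phi> = (\<lambda>x\<in>carrier G. g \<otimes>\<^bsub>G\<^esub> x \<otimes>\<^bsub>G\<^esub> inv\<^bsub>G\<^esub> g)"
    by (auto simp: Inn_def)
  have "normal_aut G (\<lambda>x. x)"
    by (auto simp: normal_aut_def iso_def hom_def bij_betw_def)
  from normal_aut_conj[OF assms this g]
  have c: "normal_aut G (\<lambda>x. g \<otimes>\<^bsub>G\<^esub> x \<otimes>\<^bsub>G\<^esub> inv\<^bsub>G\<^esub> g)" (is "normal_aut G ?c") .
  have eq: "\<phi> x = ?c x" if "x \<in> carrier G" for x using that by (simp add: \<phi>)
  have "\<phi> \<in> hom G G"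
    using c by (auto simp: normal_aut_def iso_def hom_def eq)
  moreover have "bij_betw \<phi> (carrier G) (carrier G)"
    using c by (simp add: normal_aut_def iso_def eq cong: bij_betw_cong)
  moreover have "\<phi> ` N = N" if N: "finite_index_normal N G" for N
  proof -
    have "N \<subseteq> carrier G"
      using N normal_imp_subgroup[THEN subgroup.subset] by (auto simp: finite_index_normal_def)
    then have "\<phi> ` N = ?c ` N" by (intro image_cong) (auto simp: eq)
    then show ?thesis using c N by (simp add: normal_aut_def)
  qed
  ultimately show "\<phi> \<in> Aut_nf G"
    by (simp add: Aut_nf_def auto_def Bij_def \<phi>)
qed

theorem theorem1p6:
  fixes G :: "('g, 'k) monoid_scheme"
    and A :: "('a, 'm) monoid_scheme"
    and B :: "('b, 'n) monoid_scheme"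
  assumes "group G" and "group A" and "group B"
    and "G \<cong> free_product A B"
    and "carrier A \<noteq> {\<one>\<^bsub>A\<^esub>}" and "carrier B \<noteq> {\<one>\<^bsub>B\<^esub>}"
    and "residually_finite A" and "residually_finite B"
  shows "Aut_nf G = Inn G"
proof
  show "Inn G \<subseteq> Aut_nf G" by (rule Inn_subset_Aut_nf) fact
  interpret G: group G by fact
  interpret residually_finite_factors A B
    using assms by (simp add: residually_finite_factors_def residually_finite_factors_axioms_def
        free_product_groups_def)
  obtain i where i: "i \<in> iso G P" using assms(4) by (auto simp: is_iso_def)
  interpret i: group_hom G P i
    using i G.is_group P.is_group by (simp add: group_hom_def group_hom_axioms_def iso_def)
  have bij: "bij_betw i (carrier G) (carrier P)" using i by (simp add: iso_def)
  show "Aut_nf G \<subseteq> Inn G"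
  proof
    fix \<phi> assume "\<phi> \<in> Aut_nf G"
    then have \<phi>: "normal_aut G \<phi>" "\<phi> \<in> extensional (carrier G)"
      by (auto simp: Aut_nf_def auto_def Bij_def normal_aut_def iso_def)
    have \<phi>G: "\<phi> x \<in> carrier G" if "x \<in> carrier G" for x
      using \<phi> that by (auto simp: normal_aut_def iso_def hom_def)
    \<comment> \<open>Carried over to \<open>P\<close>, \<phi> is conjugation by some
      \<open>p\<close>, whose preimage \<open>g\<close> under \<open>i\<close> will be the
      conjugator in \<open>G\<close>.\<close>
    obtain p where p: "p \<in> carrier P"
      "\<And>w. w \<in> carrier P \<Longrightarrow> i (\<phi> (inv_into (carrier G) i w)) = p \<cdot> w \<cdot> inv\<^bsub>P\<^esub> p"
      by (rule normal_aut_inner[OF normal_aut_transport[OF G.is_group P.is_group i \<phi>(1)] assms(5,6)],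
          erule that, simp)
    obtain g where g: "g \<in> carrier G" "i g = p"
    proof -
      have "p \<in> i ` carrier G" using p(1) bij_betw_imp_surj_on[OF bij] by simp
      then show thesis using that by auto
    qed
    have "\<phi> x = g \<otimes>\<^bsub>G\<^esub> x \<otimes>\<^bsub>G\<^esub> inv\<^bsub>G\<^esub> g" if x: "x \<in> carrier G" for x
    proof (rule inj_onD[OF bij_betw_imp_inj_on[OF bij]])
      show "i (\<phi> x) = i (g \<otimes>\<^bsub>G\<^esub> x \<otimes>\<^bsub>G\<^esub> inv\<^bsub>G\<^esub> g)"
        using p(2)[of "i x"] x g bij_betw_inv_into_left[OF bij x] by simp
    qed (use x g \<phi>G in auto)
    then have "\<phi> = (\<lambda>x\<in>carrier G. g \<otimes>\<^bsub>G\<^esub> x \<otimes>\<^bsub>G\<^esub> inv\<^bsub>G\<^esub> g)"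
      using \<phi>(2) by (intro extensionalityI[of _ "carrier G"]) simp_all
    with g(1) show "\<phi> \<in> Inn G" by (auto simp: Inn_def)
  qed
qed

end
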